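(* Let $\Omega_x,\Omega_y\subset\mathbb{R}$ be bounded domains, $\Omega=\Omega_x\times\Omega_y$, $f\in L^2(\Omega)$, and $g\in H^1_0(\Omega)$ the solution of $-\Delta g=f$ in $\Omega$, $g=0$ on $\partial\Omega$. Consider sequences generated as follows: $f_0^o=f$; at iteration $n\ge1$, $(r_n^o,s_n^o)\in H^1_0(\Omega_x)\times H^1_0(\Omega_y)$ satisfies, for all $(r,s)\in H^1_0(\Omega_x)\times H^1_0(\Omega_y)$, $$\int_\Omega\nabla(r_n^o\otimes s_n^o)\cdot\nabla(r_n^o\otimes s+r\otimes s_n^o)=\int_\Omega f^o_{n-1}(r_n^o\otimes s+r\otimes s_n^o);$$ then $(\alpha^{(n)}_1,\dots,\alpha^{(n)}_n)\in\mathbb{R}^n$ minimizes $(\beta_1,\dots,\beta_n)\mapsto\frac12\int_\Omega|\nabla(\sum_{k=1}^n\beta_k r_k^o\otimes s_k^o)|^2-\int_\Omega f\sum_{k=1}^n\beta_k r_k^o\otimes s_k^o$, and $f_n^o=f+\Delta(\sum_{k=1}^n\alpha^{(n)}_k r_k^o\otimes s_k^o)$, $g_n^o=g-\sum_{k=1}^n\alpha_k^{(n)}r_k^o\otimes s_k^o$. Let $E_n^o=\frac12\int_\Omega|\nabla(r_n^o\otimes s_n^o)|^2-\int_\Omega f^o_{n-1}\,r_n^o\otimes s_n^o$. Then $$\sum_{n\ge1}\int_\Omega|\nabla(r_n^o\otimes s_n^o)|^2=-2\sum_{n\ge1}E_n^o<\infty.$$ If in addition, for every $n\ge1$, $(r_n^o,s_n^o)$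 minimizes $(r,s)\mapsto\frac12\int_\Omega|\nabla(r\otimes s)|^2-\int_\Omega f^o_{n-1}\,r\otimes s$ over $H^1_0(\Omega_x)\times H^1_0(\Omega_y)$ (the Orthogonal Greedy Algorithm), then $g_n^o\to0$ in $H^1_0(\Omega)$.
   Context: Notation: $(r\otimes s)(x,y)=r(x)s(y)$. For $h\in H^{-1}(\Omega)$ and $u\in H^1_0(\Omega)$, $\int_\Omega h\,u$ denotes the duality pairing. *)

theory Defs
  imports "HOL-Analysis.Analysis"
begin

section \<open>Sobolev spaces H^1 and H^1_0 (Brezis-style, C_c^1 test functions)\<close>

definition L2 :: "'a::euclidean_space set \<Rightarrow> ('a \<Rightarrow> real) \<Rightarrow> bool" where
  "L2 U u \<longleftrightarrow> (\<lambda>x. indicator U x * u x) \<in> borel_measurable lebesgue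
      \<and> set_integrable lebesgue U (\<lambda>x. (u x)^2)"

definition testC1 :: "'a::euclidean_space set \<Rightarrow> ('a \<Rightarrow> real) set" where
  "testC1 U = {\<phi>. (\<exists>D :: 'a \<Rightarrow> ('a \<Rightarrow>\<^sub>L real).
                 (\<forall>x. (\<phi> has_derivative blinfun_apply (D x)) (at x)) \<and> continuous_on UNIV D)
             \<and> compact (closure {x. \<phi> x \<noteq> 0}) \<and> closure {x. \<phi> x \<noteq> 0} \<subseteq> U}"

definition pderiv_dir :: "('a::euclidean_space \<Rightarrow> real) \<Rightarrow> 'a \<Rightarrow> 'a \<Rightarrow> real" where
  "pderiv_dir \<phi> b x = frechet_derivative \<phi> (at x) b"

definition is_weak_grad :: "'a::euclidean_space set \<Rightarrow> ('a \<Rightarrow> real) \<Rightarrow> ('a \<Rightarrow> 'a) \<Rightarrow> bool" where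
  "is_weak_grad U u G \<longleftrightarrow>
     (\<forall>\<phi>\<in>testC1 U. \<forall>b\<in>Basis.
        (LINT x:U|lebesgue. u x * pderiv_dir \<phi> b x) = - (LINT x:U|lebesgue. (G x \<bullet> b) * \<phi> x))"

definition H1 :: "'a::euclidean_space set \<Rightarrow> ('a \<Rightarrow> real) \<Rightarrow> bool" where
  "H1 U u \<longleftrightarrow> L2 U u \<and> (\<exists>G. is_weak_grad U u G \<and> (\<forall>b\<in>Basis. L2 U (\<lambda>x. G x \<bullet> b)))"

definition wgrad :: "'a::euclidean_space set \<Rightarrow> ('a \<Rightarrow> real) \<Rightarrow> 'a \<Rightarrow> 'a" where
  "wgrad U u = (SOME G. is_weak_grad U u G \<and> (\<forall>b\<in>Basis. L2 U (\<lambda>x. G x \<bullet> b)))"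

definition dir :: "'a::euclidean_space set \<Rightarrow> ('a \<Rightarrow> real) \<Rightarrow> ('a \<Rightarrow> real) \<Rightarrow> real" where
  "dir U u v = (LINT x:U|lebesgue. wgrad U u x \<bullet> wgrad U v x)"

definition H1_normsq :: "'a::euclidean_space set \<Rightarrow> ('a \<Rightarrow> real) \<Rightarrow> real" where
  "H1_normsq U u = (LINT x:U|lebesgue. (u x)^2) + dir U u u"

definition H10 :: "'a::euclidean_space set \<Rightarrow> ('a \<Rightarrow> real) \<Rightarrow> bool" where
  "H10 U u \<longleftrightarrow> H1 U u \<and>
     (\<exists>\<phi>. (\<forall>k. \<phi> k \<in> testC1 U) \<and> (\<lambda>k. H1_normsq U (\<lambda>x. \<phi> k x - u x)) \<longlonglongrightarrow> 0)"

definition H10_norm :: "'a::euclidean_space set \<Rightarrow> ('a \<Rightarrow> real) \<Rightarrow> real" where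
  "H10_norm U u = sqrt (dir U u u)"

definition tens :: "(real \<Rightarrow> real) \<Rightarrow> (real \<Rightarrow> real) \<Rightarrow> real \<times> real \<Rightarrow> real" where
  "tens r s = (\<lambda>(x, y). r x * s y)"

definition is_domain :: "'a::euclidean_space set \<Rightarrow> bool" where
  "is_domain U \<longleftrightarrow> open U \<and> connected U \<and> U \<noteq> {}"

end

theory Submission
  imports Defs
begin

text \<open>Write \<open>a\<close> for the Dirichlet form, \<open>w\<^sub>n\<close> for the \<open>n\<close>-th tensor product and \<open>e\<^sub>n = g - u\<^sub>n\<close>
  for the error. Testing the Euler equation with \<open>(r\<^sub>n, s\<^sub>n)\<close> gives \<open>a(e\<^sub>n\<^sub>-\<^sub>1, w\<^sub>n) = a(w\<^sub>n, w\<^sub>n)\<close>, so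
  \<open>E\<^sub>n = - a(w\<^sub>n, w\<^sub>n) / 2\<close>; comparing \<open>u\<^sub>n\<close> with \<open>u\<^sub>n\<^sub>-\<^sub>1 + w\<^sub>n\<close> shows that \<open>a(e\<^sub>n, e\<^sub>n)\<close> drops by at
  least \<open>a(w\<^sub>n, w\<^sub>n)\<close> at each step, which gives summability.

  In the greedy case \<open>a(e\<^sub>n\<^sub>-\<^sub>1, w)\<^sup>2 \<le> a(w\<^sub>n, w\<^sub>n) a(w, w)\<close> for every tensor product \<open>w\<close>, hence
  \<open>a(e\<^sub>n, v)\<close> tends to 0 for every finite sum \<open>v\<close> of tensor products. Since \<open>e\<^sub>n\<close> is orthogonal to \<open>u\<^sub>n\<close>,
  \<open>a(e\<^sub>n, e\<^sub>n) = a(e\<^sub>n, g)\<close>, and approximating \<open>g\<close> by such sums finishes the proof without any use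
  of completeness. The density of the sums is seen on test functions \<open>\<phi>\<close>, whose gradients are
  approximated uniformly by those of the quasi-interpolants \<open>\<Sum> \<phi>(ih, jh) B(x/h - i) B(y/h - j)\<close> with
  \<open>B\<close> the quadratic B-spline: \<open>B\<close> is C1 and compactly supported, so for small \<open>h\<close> every
  summand is a product of test functions.\<close>

section \<open>Square-integrable functions\<close>

text \<open>\<open>wgrad\<close> is a Hilbert choice, so \<open>dir\<close> has no algebra of its
  own: bilinearity, the gradient of a tensor product and Cauchy-Schwarz all rest on the a.e.
  uniqueness of weak gradients, hence on the fundamental lemma. To avoid handling the choice
  repeatedly, membership in H^1_0 is re-expressed through an explicit L2 gradient approximated by
  test functions.

  Test functions are only C1, so squares of positive parts can replace mollifiers: they yield
  half-space functions, ball bumps and the truncated powers of the spline. Degree two is the least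
  for which a B-spline is C1. Quasi-interpolants suffice in place of interpolants: the gradient
  estimate uses only nonnegative weights of total 1.

  The greedy estimate holds because \<open>t * w\<close> is a tensor product whenever
  \<open>w\<close> is one; minimality along this line is a quadratic inequality in \<open>t\<close>,
  and its discriminant is the stated bound. Orthogonality of the error to \<open>u\<^sub>n\<close>
  comes the same way, by rescaling \<open>u\<^sub>n\<close>.\<close>

lemma discriminant_le:
  fixes A B C :: real
  assumes "\<And>t. 0 \<le> A + 2 * t * C + t\<^sup>2 * B"
  shows "C\<^sup>2 \<le> A * B"
proof -
  have A: "0 \<le> A" using assms[of 0] by simp
  show ?thesis
  proof (cases "B = 0")
    case True
    have "C = 0"
    proof (rule ccontr)
      assume "C \<noteq> 0"
      \<comment> \<open>The expression is affine in \<open>t\<close> here, and this witness gives it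
        the value -1.\<close>
      then show False using assms[of "- (A + 1) / (2 * C)"] True A by (simp add: field_simps)
    qed
    then show ?thesis using True by simp
  next
    case False
    have "B \<ge> 0"
    proof (rule ccontr)
      assume "\<not> B \<ge> 0"
      then have B: "B < 0" by simp
      \<comment> \<open>Averaging the values at \<open>t\<close> and \<open>-t\<close> removes the
        term in \<open>C\<close>. The choice gives \<open>A + t * B = B - 1\<close>, and
        \<open>t \<ge> 1\<close> with \<open>B < 0\<close> makes \<open>t\<^sup>2 * B\<close>
        smaller still.\<close>
      define t where "t = (A + 1) / (- B) + 1"
      have t1: "t \<ge> 1" using A B divide_nonneg_pos[of "A + 1" "- B"] by (simp add: t_def)
      have "- B * t = A + 1 - B" using B by (simp add: t_def field_simps)
      then have "A + t * B < 0" using B by (simp add: algebra_simps)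
      moreover have "t * B \<ge> t\<^sup>2 * B"
        using t1 B by (simp add: power2_eq_square)
      ultimately have "A + t\<^sup>2 * B < 0" by linarith
      moreover have "A + t\<^sup>2 * B \<ge> 0" using assms[of t] assms[of "-t"] by simp
      ultimately show False by simp
    qed
    then have B: "B > 0" using False by simp
    have "0 \<le> A + 2 * (- C / B) * C + (- C / B)\<^sup>2 * B" by (rule assms)
    also have "\<dots> = A - C\<^sup>2 / B" using B by (simp add: field_simps power2_eq_square)
    finally show ?thesis using B by (simp add: field_simps)
  qed
qed

definition sqint :: "'a measure \<Rightarrow> ('a \<Rightarrow> real) \<Rightarrow> bool" where
  "sqint M u \<longleftrightarrow> u \<in> borel_measurable M \<and> integrable M (\<lambda>x. (u x)\<^sup>2)"

definition sqnorm :: "'a measure \<Rightarrow> ('a \<Rightarrow> real) \<Rightarrow> real" where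
  "sqnorm M u = (LINT x|M. (u x)\<^sup>2)"

lemma sqnorm_nonneg [simp]: "0 \<le> sqnorm M u"
  by (simp add: sqnorm_def)

lemma sqint_mult_integrable:
  assumes "sqint M u" "sqint M v"
  shows "integrable M (\<lambda>x. u x * v x)"
proof (rule Bochner_Integration.integrable_bound)
  show "integrable M (\<lambda>x. (u x)\<^sup>2 + (v x)\<^sup>2)" using assms by (auto simp: sqint_def)
  show "(\<lambda>x. u x * v x) \<in> borel_measurable M" using assms by (auto simp: sqint_def)
  have "\<bar>a * b\<bar> \<le> a\<^sup>2 + b\<^sup>2" for a b :: real
  proof -
    have "\<bar>a\<bar> * \<bar>b\<bar> \<ge> 0" by simp
    then show ?thesis
      using sum_squares_bound[of "\<bar>a\<bar>" "\<bar>b\<bar>"] unfolding abs_mult power2_abs by linarith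
  qed
  then show "AE x in M. norm (u x * v x) \<le> norm ((u x)\<^sup>2 + (v x)\<^sup>2)"
    by (intro AE_I2) (simp add: abs_le_iff)
qed

lemma sqint_cmult: "sqint M u \<Longrightarrow> sqint M (\<lambda>x. c * u x)"
  by (auto simp: sqint_def power_mult_distrib)

lemma sqint_add:
  assumes "sqint M u" "sqint M v"
  shows "sqint M (\<lambda>x. u x + v x)"
  using sqint_mult_integrable[OF assms] assms
  by (auto simp: sqint_def power2_sum mult.assoc)

lemma sqint_diff:
  assumes "sqint M u" "sqint M v"
  shows "sqint M (\<lambda>x. u x - v x)"
  using sqint_add[OF assms(1) sqint_cmult[OF assms(2), of "-1"]] by simp

lemma sqnorm_cmult: "sqnorm M (\<lambda>x. c * u x) = c\<^sup>2 * sqnorm M u"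
  by (simp add: sqnorm_def power_mult_distrib)

lemma sqnorm_add_expand:
  assumes "sqint M u" "sqint M v"
  shows "sqnorm M (\<lambda>x. u x + v x) = sqnorm M u + 2 * (LINT x|M. u x * v x) + sqnorm M v"
proof -
  have "sqnorm M (\<lambda>x. u x + v x) = (LINT x|M. (u x)\<^sup>2 + (v x)\<^sup>2 + 2 * (u x * v x))"
    by (simp add: sqnorm_def power2_sum mult.assoc)
  also have "\<dots> = (LINT x|M. (u x)\<^sup>2) + (LINT x|M. (v x)\<^sup>2) + 2 * (LINT x|M. u x * v x)"
    using sqint_mult_integrable[OF assms] assms by (simp add: sqint_def)
  finally show ?thesis by (simp add: sqnorm_def)
qed

lemma sqint_Cauchy_Schwarz:
  assumes "sqint M u" "sqint M v"
  shows "(LINT x|M. u x * v x)\<^sup>2 \<le> sqnorm M u * sqnorm M v"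
proof (rule discriminant_le)
  fix t :: real
  have "0 \<le> sqnorm M (\<lambda>x. u x + t * v x)" by simp
  also have "\<dots> = sqnorm M u + 2 * t * (LINT x|M. u x * v x) + t\<^sup>2 * sqnorm M v"
    using sqnorm_add_expand[OF assms(1) sqint_cmult[OF assms(2), of t]]
    by (simp add: sqnorm_cmult mult.left_commute)
  finally show "0 \<le> sqnorm M u + 2 * t * (LINT x|M. u x * v x) + t\<^sup>2 * sqnorm M v" .
qed

text \<open>The parallelogram identity with the square of the difference dropped. It stands in for
  the triangle inequality, so that null sequences can be added without taking roots.\<close>

lemma sqnorm_add_le:
  assumes "sqint M u" "sqint M v"
  shows "sqnorm M (\<lambda>x. u x + v x) \<le> 2 * sqnorm M u + 2 * sqnorm M v"
proof -
  have "0 \<le> sqnorm M (\<lambda>x. u x + (-1) * v x)" by simp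
  also have "\<dots> = sqnorm M u - 2 * (LINT x|M. u x * v x) + sqnorm M v"
    using sqnorm_add_expand[OF assms(1) sqint_cmult[OF assms(2), of "-1"]] sqnorm_cmult[of M "-1" v]
    by simp
  finally show ?thesis
    using sqnorm_add_expand[OF assms] by simp
qed

lemma sqnorm_tendsto_0_add:
  assumes "\<And>k. sqint M (u k)" "\<And>k. sqint M (v k)"
    and "(\<lambda>k. sqnorm M (u k)) \<longlonglongrightarrow> 0" "(\<lambda>k. sqnorm M (v k)) \<longlonglongrightarrow> 0"
  shows "(\<lambda>k. sqnorm M (\<lambda>x. u k x + v k x)) \<longlonglongrightarrow> 0"
proof (rule tendsto_sandwich[OF _ _ tendsto_const])
  show "(\<lambda>k. 2 * sqnorm M (u k) + 2 * sqnorm M (v k)) \<longlonglongrightarrow> 0"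
    using tendsto_add[OF tendsto_mult_left[OF assms(3), of 2] tendsto_mult_left[OF assms(4), of 2]] by simp
qed (auto intro!: always_eventually sqnorm_add_le assms)

text \<open>Strong convergence implies weak convergence, by Cauchy-Schwarz. This carries integral
  identities from test functions to their L2 limits.\<close>

lemma sqint_integral_tendsto:
  assumes u: "\<And>k. sqint M (u k)" "sqint M u'" and v: "sqint M v"
    and lim: "(\<lambda>k. sqnorm M (\<lambda>x. u k x - u' x)) \<longlonglongrightarrow> 0"
  shows "(\<lambda>k. LINT x|M. u k x * v x) \<longlonglongrightarrow> (LINT x|M. u' x * v x)"
proof (rule LIM_zero_cancel, rule tendsto_0_le[where K = 1])
  have "(\<lambda>k. sqrt (sqnorm M (\<lambda>x. u k x - u' x) * sqnorm M v)) \<longlonglongrightarrow> sqrt (0 * sqnorm M v)"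
    by (intro tendsto_intros lim)
  then show "(\<lambda>k. sqrt (sqnorm M (\<lambda>x. u k x - u' x) * sqnorm M v)) \<longlonglongrightarrow> 0" by simp
  have "\<bar>(LINT x|M. u k x * v x) - (LINT x|M. u' x * v x)\<bar>
      \<le> sqrt (sqnorm M (\<lambda>x. u k x - u' x) * sqnorm M v)" for k
  proof -
    have "(LINT x|M. u k x * v x) - (LINT x|M. u' x * v x) = (LINT x|M. (u k x - u' x) * v x)"
      using sqint_mult_integrable[OF u(1)[of k] v] sqint_mult_integrable[OF u(2) v]
      by (simp add: left_diff_distrib)
    then show ?thesis
      using sqint_Cauchy_Schwarz[OF sqint_diff[OF u(1)[of k] u(2)] v] real_le_rsqrt
      by (metis real_sqrt_abs real_sqrt_le_iff)
  qed
  then show "\<forall>\<^sub>F k in sequentially. norm ((LINT x|M. u k x * v x) - (LINT x|M. u' x * v x))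
      \<le> norm (sqrt (sqnorm M (\<lambda>x. u k x - u' x) * sqnorm M v)) * 1"
    by (simp add: abs_le_iff)
qed

text \<open>Connects the set integrals of the given definitions with the measure
  \<open>lebesgue_on U\<close>, to which the general facts on \<open>sqint\<close> apply.\<close>

lemma set_lint_eq_restrict:
  fixes F :: "'a::euclidean_space \<Rightarrow> real"
  assumes "open U"
  shows "(LINT x:U|lebesgue. F x) = integral\<^sup>L (lebesgue_on U) F"
  using assms by (simp add: set_lebesgue_integral_def integral_restrict_space)

lemma L2_iff_sqint: "open U \<Longrightarrow> L2 U u \<longleftrightarrow> sqint (lebesgue_on U) u"
  by (simp add: L2_def sqint_def set_integrable_def integrable_restrict_space borel_measurable_restrict_space_iff)

section \<open>C1 functions and test functions\<close>

text \<open>The regularity clause of \<open>testC1\<close> without its support condition: splines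
  and bumps are first shown to be C1 and only then placed inside a domain, and C1 multipliers
  preserve test functions.\<close>

definition C1 :: "('a::euclidean_space \<Rightarrow> real) \<Rightarrow> bool" where
  "C1 \<phi> \<longleftrightarrow> (\<exists>D :: 'a \<Rightarrow> ('a \<Rightarrow>\<^sub>L real).
     (\<forall>x. (\<phi> has_derivative blinfun_apply (D x)) (at x)) \<and> continuous_on UNIV D)"

lemma C1E:
  assumes "C1 \<phi>"
  obtains D :: "'a::euclidean_space \<Rightarrow> ('a \<Rightarrow>\<^sub>L real)"
  where "\<And>x. (\<phi> has_derivative blinfun_apply (D x)) (at x)" "continuous_on UNIV D"
    "\<And>x b. pderiv_dir \<phi> b x = blinfun_apply (D x) b"
proof -
  obtain D :: "'a \<Rightarrow> ('a \<Rightarrow>\<^sub>L real)"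
    where D: "\<And>x. (\<phi> has_derivative blinfun_apply (D x)) (at x)" "continuous_on UNIV D"
    using assms unfolding C1_def by blast
  have "pderiv_dir \<phi> b x = blinfun_apply (D x) b" for x b
    using frechet_derivative_at[OF D(1), of x] by (simp add: pderiv_dir_def)
  with D show thesis by (rule that)
qed

lemma C1I:
  assumes "\<And>x. (\<phi> has_derivative blinfun_apply (D x)) (at x)" "continuous_on UNIV D"
  shows "C1 \<phi>" 
  using assms unfolding C1_def by blast

lemma C1_continuous: "C1 \<phi> \<Longrightarrow> continuous_on UNIV \<phi>"
  by (erule C1E) (meson continuous_at_imp_continuous_on has_derivative_continuous)

lemma C1_pderiv_continuous: 
  assumes "C1 \<phi>" shows "continuous_on UNIV (pderiv_dir \<phi> b)"
proof -
  obtain D where D: "continuous_on UNIV D" "\<And>x. pderiv_dir \<phi> b x = blinfun_apply (D x) b"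
    by (rule C1E[OF assms]) blast
  have "continuous_on UNIV (\<lambda>x. blinfun_apply (D x) b)"
    by (intro continuous_intros D(1))
  then show ?thesis by (simp add: D(2) [abs_def])
qed

lemma pderiv_dir_eqI: "(\<phi> has_derivative F) (at x) \<Longrightarrow> pderiv_dir \<phi> b x = F b"
  by (simp add: pderiv_dir_def flip: frechet_derivative_at)

lemma C1_has_derivative: "C1 \<phi> \<Longrightarrow> (\<phi> has_derivative (\<lambda>b. pderiv_dir \<phi> b x)) (at x)"
  by (erule C1E) simp

lemma C1_const [simp]: "C1 (\<lambda>x. c)"
  by (rule C1I[where D = "\<lambda>x. 0"]) (auto simp: zero_blinfun.rep_eq)

lemma C1_add:
  assumes "C1 \<phi>" "C1 \<psi>"
  shows "C1 (\<lambda>x. \<phi> x + \<psi> x)" "pderiv_dir (\<lambda>x. \<phi> x + \<psi> x) b x = pderiv_dir \<phi> b x + pderiv_dir \<psi> b x"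
proof -
  obtain D D' where D: "\<And>x. (\<phi> has_derivative blinfun_apply (D x)) (at x)" "continuous_on UNIV D"
    "\<And>x. (\<psi> has_derivative blinfun_apply (D' x)) (at x)" "continuous_on UNIV D'"
    using assms unfolding C1_def by blast
  show "C1 (\<lambda>x. \<phi> x + \<psi> x)"
  proof (rule C1I[where D = "\<lambda>x. D x + D' x"])
    show "((\<lambda>x. \<phi> x + \<psi> x) has_derivative blinfun_apply (D x + D' x)) (at x)" for x
      using has_derivative_add[OF D(1,3)[of x]] by (simp add: blinfun.add_left [abs_def])
  qed (intro continuous_intros D)
  show "pderiv_dir (\<lambda>x. \<phi> x + \<psi> x) b x = pderiv_dir \<phi> b x + pderiv_dir \<psi> b x"
    using has_derivative_add[OF C1_has_derivative[OF assms(1)] C1_has_derivative[OF assms(2)]]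
    by (rule pderiv_dir_eqI)
qed

lemma C1_mult:
  assumes "C1 \<phi>" "C1 \<psi>"
  shows "C1 (\<lambda>x. \<phi> x * \<psi> x)" 
    "pderiv_dir (\<lambda>x. \<phi> x * \<psi> x) b x = \<phi> x * pderiv_dir \<psi> b x + pderiv_dir \<phi> b x * \<psi> x"
proof -
  obtain D D' where D: "\<And>x. (\<phi> has_derivative blinfun_apply (D x)) (at x)" "continuous_on UNIV D"
    "\<And>x. (\<psi> has_derivative blinfun_apply (D' x)) (at x)" "continuous_on UNIV D'"
    using assms unfolding C1_def by blast
  show "C1 (\<lambda>x. \<phi> x * \<psi> x)"
  proof (rule C1I[where D = "\<lambda>x. \<phi> x *\<^sub>R D' x + \<psi> x *\<^sub>R D x"])
    show "((\<lambda>x. \<phi> x * \<psi> x) has_derivative blinfun_apply (\<phi> x *\<^sub>R D' x + \<psi> x *\<^sub>R D x)) (at x)" for x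
      using has_derivative_mult[OF D(1,3)[of x]]
      by (simp add: blinfun.add_left [abs_def] blinfun.scaleR_left mult.commute)
  qed (intro continuous_intros D C1_continuous assms)
  show "pderiv_dir (\<lambda>x. \<phi> x * \<psi> x) b x = \<phi> x * pderiv_dir \<psi> b x + pderiv_dir \<phi> b x * \<psi> x"
    using has_derivative_mult[OF C1_has_derivative[OF assms(1)] C1_has_derivative[OF assms(2)]]
    by (rule pderiv_dir_eqI)
qed

lemma C1_cmult:
  assumes "C1 \<phi>"
  shows "C1 (\<lambda>x. c * \<phi> x)" "pderiv_dir (\<lambda>x. c * \<phi> x) b x = c * pderiv_dir \<phi> b x"
  using C1_mult[OF C1_const assms, of c] pderiv_dir_eqI[OF has_derivative_const, of c b x] by auto

lemma C1_compose:
  assumes "C1 \<phi>" and p: "\<And>t. (p has_real_derivative p' t) (at t)" "continuous_on UNIV p'"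
  shows "C1 (\<lambda>x. p (\<phi> x))"
proof -
  obtain D where D: "\<And>x. (\<phi> has_derivative blinfun_apply (D x)) (at x)" "continuous_on UNIV D"
    using assms unfolding C1_def by blast
  show ?thesis
  proof (rule C1I[where D = "\<lambda>x. p' (\<phi> x) *\<^sub>R D x"])
    have "continuous_on UNIV (\<lambda>x. p' (\<phi> x))"
      using continuous_on_compose2[OF p(2) C1_continuous[OF assms(1)]] by simp
    then show "continuous_on UNIV (\<lambda>x. p' (\<phi> x) *\<^sub>R D x)"
      by (intro continuous_intros D)
    show "((\<lambda>x. p (\<phi> x)) has_derivative blinfun_apply (p' (\<phi> x) *\<^sub>R D x)) (at x)" for x
      using has_derivative_compose[OF D(1) p(1)[THEN has_field_derivative_imp_has_derivative]]
      by (simp add: blinfun.scaleR_left [abs_def])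
  qed
qed

lemma C1_real:
  assumes "\<And>t. (p has_real_derivative p' t) (at t)" "continuous_on UNIV p'"
  shows "C1 p" "pderiv_dir p 1 t = p' t"
proof -
  have "C1 (\<lambda>x::real. x)"
    by (rule C1I[where D = "\<lambda>x. id_blinfun"]) (auto simp: id_def)
  from C1_compose[OF this assms] show "C1 p" by simp
  show "pderiv_dir p 1 t = p' t"
    using pderiv_dir_eqI[OF assms(1)[THEN has_field_derivative_imp_has_derivative], of 1] by simp
qed

lemma C1_real_has_derivative:
  assumes "C1 p"
  shows "(p has_real_derivative pderiv_dir p 1 t) (at t)"
proof -
  have "bounded_linear (\<lambda>b. pderiv_dir p b t)"
    using C1_has_derivative[OF assms] has_derivative_bounded_linear by blast
  then have "pderiv_dir p b t = pderiv_dir p 1 t * b" for b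
    using linear_scale[OF bounded_linear.linear, of "\<lambda>b. pderiv_dir p b t" b 1] by (simp add: mult.commute)
  then have "(\<lambda>b. pderiv_dir p b t) = (*) (pderiv_dir p 1 t)" by (rule ext)
  with C1_has_derivative[OF assms, of t] show ?thesis
    unfolding has_field_derivative_def by metis
qed

text \<open>The squared positive part is the simplest C1 function that vanishes on a half-line
  without being 0; every explicit bump and spline below is composed from it. At 0 the difference
  quotient is at most the absolute value of the increment.\<close>

lemma pos_part_power2_has_derivative:
  "((\<lambda>t::real. (max 0 t)\<^sup>2) has_real_derivative 2 * max 0 t) (at t)"
proof (cases t "0::real" rule: linorder_cases)
  case less
  have "((\<lambda>t::real. 0) has_real_derivative 0) (at t)" by simp
  then have "((\<lambda>t::real. (max 0 t)\<^sup>2) has_real_derivative 0) (at t)"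
    by (rule has_field_derivative_transform_within_open[of _ _ _ "{..<0}"]) (use less in auto)
  then show ?thesis using less by simp
next
  case greater
  have "((\<lambda>t::real. t\<^sup>2) has_real_derivative 2 * t) (at t)" 
    by (auto intro!: derivative_eq_intros)
  then have "((\<lambda>t::real. (max 0 t)\<^sup>2) has_real_derivative 2 * t) (at t)"
    by (rule has_field_derivative_transform_within_open[of _ _ _ "{0<..}"]) (use greater in auto)
  then show ?thesis using greater by simp
next
  case equal
  have "((\<lambda>h::real. \<bar>h\<bar>) \<longlongrightarrow> 0) (at 0)"
    using tendsto_rabs[OF tendsto_ident_at, of 0] by simp
  then have "((\<lambda>h::real. (max 0 h)\<^sup>2 / h) \<longlongrightarrow> 0) (at 0)"
    by (rule tendsto_0_le[where K = 1]) 
      (auto intro!: always_eventually simp: power2_eq_square max_def)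
  then show ?thesis using equal by (simp add: has_field_derivative_iff)
qed

lemma C1_pos_part_power2: "C1 \<phi> \<Longrightarrow> C1 (\<lambda>x. (max 0 (\<phi> x))\<^sup>2)"
  by (rule C1_compose[OF _ pos_part_power2_has_derivative]) (auto intro!: continuous_intros)

text \<open>This function is nonzero exactly on an open half-space, and such half-spaces generate
  the Borel sets.\<close>

lemma C1_halfspace: "C1 (\<lambda>x::'a::euclidean_space. (max 0 (a - x \<bullet> i))\<^sup>2)"
proof (rule C1_pos_part_power2)
  show "C1 (\<lambda>x. a - x \<bullet> i)"
    by (rule C1I[where D = "\<lambda>x. - blinfun_inner_left i"])
      (auto intro!: derivative_eq_intros simp: blinfun.minus_left)
qed

text \<open>For \<open>e > 0\<close> this function is nonzero exactly on the open ball, which allows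
  localisation in the fundamental lemma.\<close>

lemma C1_ball_bump: "C1 (\<lambda>x::'a::euclidean_space. (max 0 (e\<^sup>2 - (x - c) \<bullet> (x - c)))\<^sup>2)"
proof (rule C1_pos_part_power2)
  show "C1 (\<lambda>x. e\<^sup>2 - (x - c) \<bullet> (x - c))"
  proof (rule C1I[where D = "\<lambda>x. (- 2) *\<^sub>R blinfun_inner_left (x - c)"])
    show "((\<lambda>x. e\<^sup>2 - (x - c) \<bullet> (x - c)) has_derivative
        blinfun_apply ((- 2) *\<^sub>R blinfun_inner_left (x - c))) (at x)" for x
      by (rule has_derivative_eq_rhs, (rule derivative_intros)+)
        (auto simp: blinfun.scaleR_left blinfun.minus_left inner_commute)
  qed (intro continuous_intros bounded_linear.continuous_on[OF bounded_linear_blinfun_inner_left])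
qed

section \<open>Test functions and their supports\<close>

lemma testC1_iff: 
  "\<phi> \<in> testC1 U \<longleftrightarrow> C1 \<phi> \<and> compact (closure {x. \<phi> x \<noteq> 0}) \<and> closure {x. \<phi> x \<noteq> 0} \<subseteq> U"
  by (simp add: testC1_def C1_def)

lemma testC1I:
  assumes "C1 \<phi>" "compact K" "K \<subseteq> U" "\<And>x. x \<notin> K \<Longrightarrow> \<phi> x = 0"
  shows "\<phi> \<in> testC1 U"
proof -
  have "closure {x. \<phi> x \<noteq> 0} \<subseteq> K"
    using assms by (intro closure_minimal) (auto intro: compact_imp_closed)
  moreover have "compact (closure {x. \<phi> x \<noteq> 0})"
    using calculation assms(2) by (meson bounded_subset closed_closure compact_eq_bounded_closed)
  ultimately show ?thesis using assms by (auto simp: testC1_iff)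
qed

text \<open>Off its closed support the function is locally 0, so a single compact set serves for the
  function and for all its derivatives.\<close>

lemma testC1E:
  assumes "\<phi> \<in> testC1 U"
  obtains K where "C1 \<phi>" "compact K" "K \<subseteq> U" "\<And>x. x \<notin> K \<Longrightarrow> \<phi> x = 0"
    "\<And>x b. x \<notin> K \<Longrightarrow> pderiv_dir \<phi> b x = 0"
proof -
  let ?K = "closure {x. \<phi> x \<noteq> 0}"
  have "pderiv_dir \<phi> b x = 0" if "x \<notin> ?K" for x b
  proof -
    have "((\<lambda>x. 0) has_derivative (\<lambda>x. 0)) (at x)" by simp
    then have "(\<phi> has_derivative (\<lambda>x. 0)) (at x)"
      by (rule has_derivative_transform_within_open[where s = "- ?K"])
        (use that closure_subset[of "{x. \<phi> x \<noteq> 0}"] in auto)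
    then show ?thesis by (rule pderiv_dir_eqI)
  qed
  moreover have "\<phi> x = 0" if "x \<notin> ?K" for x
    using that closure_subset[of "{x. \<phi> x \<noteq> 0}"] by blast
  moreover have "C1 \<phi>" "compact ?K" "?K \<subseteq> U" using assms unfolding testC1_iff by blast+
  ultimately show thesis by (intro that[of ?K])
qed

lemma testC1_mult_C1:
  assumes "\<phi> \<in> testC1 U" "C1 \<psi>"
  shows "(\<lambda>x. \<psi> x * \<phi> x) \<in> testC1 U"
proof -
  obtain K where K: "C1 \<phi>" "compact K" "K \<subseteq> U" "\<And>x. x \<notin> K \<Longrightarrow> \<phi> x = 0"
    by (rule testC1E[OF assms(1)]) blast
  show ?thesis
    by (rule testC1I[OF C1_mult(1)[OF assms(2) K(1)] K(2,3)]) (simp add: K(4))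
qed

lemma testC1_cmult: "\<phi> \<in> testC1 U \<Longrightarrow> (\<lambda>x. c * \<phi> x) \<in> testC1 U"
  by (rule testC1_mult_C1) auto

lemma testC1_add:
  assumes "\<phi> \<in> testC1 U" "\<psi> \<in> testC1 U"
  shows "(\<lambda>x. \<phi> x + \<psi> x) \<in> testC1 U"
proof -
  obtain K where K: "C1 \<phi>" "compact K" "K \<subseteq> U" "\<And>x. x \<notin> K \<Longrightarrow> \<phi> x = 0"
    by (rule testC1E[OF assms(1)]) blast
  obtain L where L: "C1 \<psi>" "compact L" "L \<subseteq> U" "\<And>x. x \<notin> L \<Longrightarrow> \<psi> x = 0"
    by (rule testC1E[OF assms(2)]) blast
  show ?thesis
    by (rule testC1I[where K = "K \<union> L"]) (use K L in \<open>auto intro: C1_add(1)\<close>)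
qed

lemma testC1_0 [simp]: "(\<lambda>x. 0) \<in> testC1 U"
  by (rule testC1I[where K = "{}"]) auto

lemma continuous_compact_support_sqint:
  fixes w :: "'a::euclidean_space \<Rightarrow> real"
  assumes "open U" "continuous_on UNIV w" "compact K" "\<And>x. x \<notin> K \<Longrightarrow> w x = 0"
  shows "sqint (lebesgue_on U) w" "integrable lebesgue w"
proof -
  have int: "integrable lebesgue v"
    if v: "continuous_on UNIV v" "\<And>x. x \<notin> K \<Longrightarrow> v x = 0" for v :: "'a \<Rightarrow> real"
  proof -
    have "integrable lborel (\<lambda>x. indicator K x *\<^sub>R v x)"
      using v assms by (intro borel_integrable_compact) (auto elim: continuous_on_subset)
    moreover have "(\<lambda>x. indicator K x *\<^sub>R v x) = v"
      using v(2) by (auto simp: indicator_def fun_eq_iff)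
    ultimately show ?thesis by (simp add: integrable_completion)
  qed
  show "integrable lebesgue w" by (rule int[OF assms(2,4)])
  have "integrable lebesgue (\<lambda>x. (w x)\<^sup>2)"
    using assms by (intro int continuous_intros) auto
  then have "integrable lebesgue (\<lambda>x. indicator U x *\<^sub>R (w x)\<^sup>2)"
    using assms(1) by (intro integrable_mult_indicator) auto
  moreover have "w \<in> borel_measurable (lebesgue_on U)"
    using int[OF assms(2,4)] by (intro measurable_restrict_space1) auto
  ultimately show "sqint (lebesgue_on U) w"
    using assms(1) by (simp add: sqint_def integrable_restrict_space)
qed

lemma testC1_sqint:
  assumes "open U" "\<phi> \<in> testC1 V"
  shows "sqint (lebesgue_on U) \<phi>" "sqint (lebesgue_on U) (pderiv_dir \<phi> b)"
    "integrable lebesgue \<phi>" "integrable lebesgue (pderiv_dir \<phi> b)"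
proof -
  obtain K where K: "C1 \<phi>" "compact K" "\<And>x. x \<notin> K \<Longrightarrow> \<phi> x = 0"
    "\<And>x b. x \<notin> K \<Longrightarrow> pderiv_dir \<phi> b x = 0"
    by (rule testC1E[OF assms(2)]) blast
  note * = continuous_compact_support_sqint[OF assms(1) C1_continuous[OF K(1)] K(2,3)]
    continuous_compact_support_sqint[OF assms(1) C1_pderiv_continuous[OF K(1)] K(2,4)]
  show "sqint (lebesgue_on U) \<phi>" "sqint (lebesgue_on U) (pderiv_dir \<phi> b)"
    "integrable lebesgue \<phi>" "integrable lebesgue (pderiv_dir \<phi> b)"
    using * by auto
qed

section \<open>The fundamental lemma of the calculus of variations\<close>

text \<open>The sets \<open>{x. \<psi> x \<noteq> 0}\<close> with \<open>\<psi>\<close> C1 form an intersection-stable generator of the Borel sets, and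
  \<open>n \<psi>\<^sup>2 / (1 + n \<psi>\<^sup>2)\<close> are C1 functions increasing to their indicators.\<close>

lemma C1_orthogonal_imp_AE_0:
  fixes k :: "'a::euclidean_space \<Rightarrow> real"
  assumes k: "integrable lebesgue k"
    and z: "\<And>\<psi>. C1 \<psi> \<Longrightarrow> (LINT x|lebesgue. \<psi> x * k x) = 0"
  shows "AE x in lebesgue. k x = 0"
proof -
  have km [measurable]: "k \<in> borel_measurable lebesgue" using k by simp
  have V: "(LINT x|lebesgue. indicator {x. \<psi> x \<noteq> 0} x * k x) = 0" if \<psi>: "C1 \<psi>" for \<psi>
  proof -
    have \<psi>m [measurable]: "\<psi> \<in> borel_measurable lebesgue"
      using borel_measurable_continuous_onI[OF C1_continuous[OF \<psi>]]
      by (intro measurable_completion) simp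
    let ?q = "\<lambda>n t. real n * t\<^sup>2 / (1 + real n * t\<^sup>2)"
    have pos: "1 + real n * t\<^sup>2 > 0" for n and t :: real
      by (smt (verit) of_nat_0_le_iff zero_le_mult_iff zero_le_power2)
    have lim: "(\<lambda>n. ?q n t) \<longlonglongrightarrow> (if t \<noteq> 0 then 1 else 0)" for t :: real
    proof (cases "t = 0")
      case False
      have "(\<lambda>n. 1 - 1 / (1 + real n * t\<^sup>2)) \<longlonglongrightarrow> 1 - 0"
        by (intro tendsto_intros tendsto_divide_0[OF tendsto_const] filterlim_at_top_imp_at_infinity
            filterlim_tendsto_add_at_top[OF tendsto_const]
            filterlim_at_top_mult_tendsto_pos[OF tendsto_const _ filterlim_real_sequentially])
          (use False in auto)
      moreover have "1 - 1 / (1 + real n * t\<^sup>2) = ?q n t" for n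
        using pos[of n t] by (simp add: field_simps)
      ultimately show ?thesis using False by simp
    qed auto
    have "(\<lambda>n. LINT x|lebesgue. ?q n (\<psi> x) * k x)
        \<longlonglongrightarrow> (LINT x|lebesgue. indicator {x. \<psi> x \<noteq> 0} x * k x)"
    proof (rule integral_dominated_convergence[where w = "\<lambda>x. \<bar>k x\<bar>"])
      show "AE x in lebesgue. (\<lambda>n. ?q n (\<psi> x) * k x) \<longlonglongrightarrow> indicator {x. \<psi> x \<noteq> 0} x * k x"
      proof (intro AE_I2 tendsto_mult_right)
        show "(\<lambda>n. ?q n (\<psi> x)) \<longlonglongrightarrow> indicator {x. \<psi> x \<noteq> 0} x" for x
          using lim[of "\<psi> x"] by (cases "\<psi> x = 0") auto
      qed
      have "\<bar>?q n t\<bar> \<le> 1" for n t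
        using pos[of n t] by (auto simp: abs_le_iff field_simps)
      then show "AE x in lebesgue. norm (?q n (\<psi> x) * k x) \<le> \<bar>k x\<bar>" for n
        by (intro AE_I2) (simp add: abs_mult mult_left_le_one_le del: times_divide_eq_left)
    qed (use k in auto)
    moreover have "(LINT x|lebesgue. ?q n (\<psi> x) * k x) = 0" for n
    proof (rule z, rule C1_compose[OF \<psi>])
      let ?q' = "\<lambda>t. 2 * real n * t / (1 + real n * t\<^sup>2)\<^sup>2"
      show "(?q n has_real_derivative ?q' t) (at t)" for t
        using pos[of n t] by (auto intro!: derivative_eq_intros simp: power2_eq_square field_simps)
      show "continuous_on UNIV ?q'"
        using pos[of n] by (intro continuous_intros) (auto simp: less_imp_neq[symmetric])
    qed
    ultimately show ?thesis by (simp add: LIMSEQ_const_iff)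
  qed
  define E where "E = (\<lambda>\<psi>::'a \<Rightarrow> real. {x. \<psi> x \<noteq> 0}) ` Collect C1"
  have EI: "A \<in> E" if "A = {x. \<psi> x \<noteq> 0}" "C1 \<psi>" for A \<psi>
    unfolding E_def by (rule image_eqI[of _ _ \<psi>]) (use that in simp_all)
  have EE: "\<exists>\<psi>. A = {x. \<psi> x \<noteq> 0} \<and> C1 \<psi>" if "A \<in> E" for A
    using that unfolding E_def image_iff by simp metis
  have stable: "Int_stable E"
  proof (rule Int_stableI)
    fix A B assume AB: "A \<in> E" "B \<in> E"
    obtain \<phi> where \<phi>: "A = {x. \<phi> x \<noteq> 0}" "C1 \<phi>" using EE[OF AB(1)] by (elim exE conjE)
    obtain \<psi> where \<psi>: "B = {x. \<psi> x \<noteq> 0}" "C1 \<psi>" using EE[OF AB(2)] by (elim exE conjE)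
    have "A \<inter> B = {x. \<phi> x * \<psi> x \<noteq> 0}" unfolding \<phi>(1) \<psi>(1) by auto
    then show "A \<inter> B \<in> E" using C1_mult(1)[OF \<phi>(2) \<psi>(2)] by (rule EI)
  qed
  have "open A" if "A \<in> E" for A
  proof -
    obtain \<psi> where "A = {x. \<psi> x \<noteq> 0}" "C1 \<psi>" using EE[OF \<open>A \<in> E\<close>] by (elim exE conjE)
    then show ?thesis by (simp add: open_Collect_neq C1_continuous)
  qed
  then have "E \<subseteq> sets borel" by (meson borel_open subsetI)
  then have Eb: "sigma_sets UNIV E \<subseteq> sets borel"
    using sets.sigma_sets_subset[of E borel] by simp
  have half: "(\<lambda>(a, i). {x::'a. x \<bullet> i < a}) ` (UNIV \<times> Basis) \<subseteq> sigma_sets UNIV E"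
  proof safe
    fix a :: real and i :: 'a
    have "{x. x \<bullet> i < a} = {x. (max 0 (a - x \<bullet> i))\<^sup>2 \<noteq> 0}" by auto
    then have "{x. x \<bullet> i < a} \<in> E" using C1_halfspace by (rule EI)
    then show "{x. x \<bullet> i < a} \<in> sigma_sets UNIV E" by (rule sigma_sets.Basic)
  qed
  have bE: "sets borel \<subseteq> sigma_sets UNIV E"
    using sigma_sets_mono[OF half] by (subst borel_eq_halfspace_less) simp
  have EP: "E \<subseteq> Pow UNIV" by simp
  \<comment> \<open>A Dynkin argument over the intersection-stable generator. The complement case
    starts from the integral of \<open>k\<close> over the whole space, which is 0 because the
    constant 1 is C1.\<close>
  have zero: "(LINT x|lebesgue. indicator A x * k x) = 0" if "A \<in> sigma_sets UNIV E" for A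
    using stable EP that
  proof (induction rule: sigma_sets_induct_disjoint)
    case (basic A)
    obtain \<psi> where "A = {x. \<psi> x \<noteq> 0}" "C1 \<psi>" using EE[OF basic] by (elim exE conjE)
    then show ?case using V by simp
  next
    case empty show ?case by simp
  next
    case (compl A)
    have [measurable]: "A \<in> sets lebesgue" using compl(1) Eb by auto
    have "(LINT x|lebesgue. indicator (UNIV - A) x * k x)
        = (LINT x|lebesgue. indicator UNIV x * k x - indicator A x * k x)"
      by (intro Bochner_Integration.integral_cong) (auto simp: indicator_def)
    also have "\<dots> = (LINT x|lebesgue. indicator UNIV x * k x) - (LINT x|lebesgue. indicator A x * k x)"
      using integrable_mult_indicator[OF _ k, of A] k
      by (intro Bochner_Integration.integral_diff) auto
    finally show ?case using compl(2) z[of "\<lambda>x. 1"] by simp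
  next
    case (union A)
    have "A i \<in> sets borel" for i using union(2) Eb by blast
    then have [measurable]: "A i \<in> sets lebesgue" for i by simp
    have "(LINT x:(\<Union>i. A i)|lebesgue. k x) = (\<Sum>i. (LINT x:(A i)|lebesgue. k x))"
      using union(1) integrable_mult_indicator[OF _ k, of "\<Union>i. A i"]
      by (intro lebesgue_integral_countable_add) (auto simp: disjoint_family_on_def set_integrable_def)
    then show ?case using union(3) by (simp add: set_lebesgue_integral_def)
  qed
  \<comment> \<open>The induction reaches only Borel sets, while \<open>k\<close> is merely Lebesgue
    measurable; a Borel representative makes the uniqueness of densities applicable.\<close>
  obtain k0 where k0 [measurable]: "k0 \<in> borel_measurable lborel" and AE: "AE x in lborel. k x = k0 x"
    using completion_ex_borel_measurable_real[OF km] by blast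
  have AE': "AE x in lebesgue. k x = k0 x" using AE by (rule AE_completion)
  have k0m: "k0 \<in> borel_measurable lebesgue" by (rule measurable_completion) measurable
  have k0i: "integrable lborel k0"
    using k AE' k0m k0 integrable_cong_AE[of k lebesgue k0] by (simp add: integrable_completion)
  have "AE x in lborel. k0 x = 0"
  proof (rule density_unique_real[OF k0i])
    fix A :: "'a set" assume A: "A \<in> sets lborel"
    then have Al: "A \<in> sets lebesgue" by auto
    have "(LINT x:A|lborel. k0 x) = (LINT x|lebesgue. indicator A x * k0 x)"
      using A by (simp add: set_lebesgue_integral_def integral_completion)
    also have "\<dots> = (LINT x|lebesgue. indicator A x * k x)"
      using AE' Al k0m km by (intro integral_cong_AE borel_measurable_times borel_measurable_indicator) auto
    also have "\<dots> = 0" using A bE by (intro zero) auto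
    finally show "(LINT x:A|lborel. k0 x) = (LINT x:A|lborel. 0)" by (simp add: set_lebesgue_integral_def)
  qed simp
  then have "AE x in lebesgue. k0 x = 0" by (rule AE_completion)
  with AE' show ?thesis by eventually_elim simp
qed

text \<open>Localisation of the previous lemma: a ball bump times any C1 function is a test
  function, so \<open>h\<close> times the bump is orthogonal to all C1 functions and vanishes a.e.
  The bump has no zero in the open ball, hence \<open>h\<close> itself vanishes a.e. there.\<close>

lemma testC1_orthogonal_imp_AE_0:
  fixes h :: "'a::euclidean_space \<Rightarrow> real"
  assumes U: "open U" and h: "sqint (lebesgue_on U) h"
    and z: "\<And>\<phi>. \<phi> \<in> testC1 U \<Longrightarrow> (LINT x|lebesgue_on U. h x * \<phi> x) = 0"
  shows "AE x in lebesgue_on U. h x = 0"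
proof -
  have ball: "AE x in lebesgue. x \<in> ball c e \<longrightarrow> h x = 0" if sub: "cball c e \<subseteq> U" for c e
  proof -
    let ?\<theta> = "\<lambda>x. (max 0 (e\<^sup>2 - (x - c) \<bullet> (x - c)))\<^sup>2"
    have \<theta>: "?\<theta> \<in> testC1 U" if "e > 0"
    proof (rule testC1I[OF C1_ball_bump compact_cball sub])
      fix x assume "x \<notin> cball c e"
      then have "e < norm (x - c)" by (simp add: dist_norm norm_minus_commute)
      then have "e\<^sup>2 \<le> (norm (x - c))\<^sup>2" using that by (intro power_mono) auto
      then show "?\<theta> x = 0" by (simp add: power2_norm_eq_inner)
    qed
    show ?thesis
    proof (cases "e > 0")
      case True
      have "AE x in lebesgue. indicator U x * (h x * ?\<theta> x) = 0"
      proof (rule C1_orthogonal_imp_AE_0)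
        have "integrable (lebesgue_on U) (\<lambda>x. h x * ?\<theta> x)"
          by (rule sqint_mult_integrable[OF h testC1_sqint(1)[OF U \<theta>[OF True]]])
        then show "integrable lebesgue (\<lambda>x. indicator U x * (h x * ?\<theta> x))"
          using U by (simp add: integrable_restrict_space)
        fix \<psi> :: "'a \<Rightarrow> real" assume "C1 \<psi>"
        from z[OF testC1_mult_C1[OF \<theta>[OF True] this]]
        show "(LINT x|lebesgue. \<psi> x * (indicator U x * (h x * ?\<theta> x))) = 0"
          using U by (simp add: integral_restrict_space ac_simps)
      qed
      then show ?thesis
      proof eventually_elim
        case (elim x)
        show ?case
        proof
          assume x: "x \<in> ball c e"
          then have "norm (x - c) < e" by (simp add: dist_norm norm_minus_commute)
          then have "(norm (x - c))\<^sup>2 < e\<^sup>2" using True by (intro power_strict_mono) auto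
          then have "?\<theta> x \<noteq> 0" by (simp add: power2_norm_eq_inner)
          moreover have "x \<in> U" using x sub by auto
          ultimately show "h x = 0" using elim
            by (metis indicator_simps(1) mult_eq_0_iff zero_neq_one)
        qed
      qed
    qed (auto simp: ball_empty)
  qed
  define F where "F = {ball c e |c e. cball c e \<subseteq> U}"
  \<comment> \<open>Only countably many null sets may be united, so the cover by balls is thinned to
    a countable one.\<close>
  obtain F' where F': "F' \<subseteq> F" "countable F'" "\<Union>F' = \<Union>F"
    by (rule Lindelof[of F]) (auto simp: F_def)
  have "AE x in lebesgue. \<forall>S\<in>F'. x \<in> S \<longrightarrow> h x = 0"
    using F'(1) ball by (subst AE_ball_countable[OF F'(2)]) (auto simp: F_def)
  moreover have "\<Union>F = U"
  proof
    show "U \<subseteq> \<Union>F"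
    proof
      fix x assume "x \<in> U"
      then obtain e where "e > 0" "cball x e \<subseteq> U" using U open_contains_cball by blast
      then have "ball x e \<in> F" "x \<in> ball x e" by (auto simp: F_def)
      then show "x \<in> \<Union>F" by blast
    qed
  qed (force simp: F_def)
  ultimately have "AE x in lebesgue. x \<in> U \<longrightarrow> h x = 0"
    using F'(3) by (elim eventually_mono) blast
  then show ?thesis using U by (simp add: AE_restrict_space_iff)
qed

section \<open>Weak gradients\<close>

lemma C1_line_has_derivative:
  assumes "C1 \<phi>"
  shows "((\<lambda>t. \<phi> (x + t *\<^sub>R b)) has_real_derivative pderiv_dir \<phi> b (x + t *\<^sub>R b)) (at t)"
proof -
  have "((\<lambda>t. x + t *\<^sub>R b) has_derivative (\<lambda>t. t *\<^sub>R b)) (at t)"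
    by (auto intro!: derivative_eq_intros)
  from has_derivative_compose[OF this C1_has_derivative[OF assms]]
  have *: "((\<lambda>t. \<phi> (x + t *\<^sub>R b)) has_derivative (\<lambda>h. pderiv_dir \<phi> (h *\<^sub>R b) (x + t *\<^sub>R b))) (at t)" .
  have "bounded_linear (\<lambda>b. pderiv_dir \<phi> b (x + t *\<^sub>R b'))" for b'
    using C1_has_derivative[OF assms] has_derivative_bounded_linear by blast
  then have "pderiv_dir \<phi> (h *\<^sub>R b) (x + t *\<^sub>R b) = pderiv_dir \<phi> b (x + t *\<^sub>R b) * h" for h
    using linear_scale[OF bounded_linear.linear, of "\<lambda>b'. pderiv_dir \<phi> b' (x + t *\<^sub>R b)" h b]
    by (simp add: mult.commute)
  then have "(\<lambda>h. pderiv_dir \<phi> (h *\<^sub>R b) (x + t *\<^sub>R b)) = (*) (pderiv_dir \<phi> b (x + t *\<^sub>R b))"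
    by (rule ext)
  with * show ?thesis unfolding has_field_derivative_def by metis
qed

text \<open>The difference quotients of \<open>\<phi>\<close> have integral 0 by translation invariance.\<close>

lemma integral_pderiv_dir_eq_0:
  fixes \<phi> :: "'a::euclidean_space \<Rightarrow> real"
  assumes "\<phi> \<in> testC1 U"
  shows "(LINT x|lebesgue. pderiv_dir \<phi> b x) = 0"
proof -
  obtain K where K: "C1 \<phi>" "compact K" "\<And>x. x \<notin> K \<Longrightarrow> \<phi> x = 0" "\<And>x. x \<notin> K \<Longrightarrow> pderiv_dir \<phi> b x = 0"
    by (rule testC1E[OF assms]) blast
  obtain R where R: "\<And>x. x \<in> K \<Longrightarrow> norm x \<le> R"
    using compact_imp_bounded[OF K(2)] unfolding bounded_iff by blast
  have "compact (pderiv_dir \<phi> b ` K)"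
    using continuous_on_subset[OF C1_pderiv_continuous[OF K(1)]] K(2)
    by (intro compact_continuous_image) auto
  then obtain C where C: "\<And>x. x \<in> K \<Longrightarrow> \<bar>pderiv_dir \<phi> b x\<bar> \<le> C"
    using compact_imp_bounded[of "pderiv_dir \<phi> b ` K"] unfolding bounded_iff by auto
  have C': "\<bar>pderiv_dir \<phi> b x\<bar> \<le> \<bar>C\<bar>" for x
    using C[of x] K(4)[of x] by (cases "x \<in> K") auto
  have meas [measurable]: "\<phi> \<in> borel_measurable borel" "pderiv_dir \<phi> b \<in> borel_measurable borel"
    by (intro borel_measurable_continuous_onI C1_continuous C1_pderiv_continuous K)+
  define h where "h n = inverse (real (Suc n))" for n
  have h: "0 < h n" "h n \<le> 1" for n by (auto simp: h_def field_simps)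
  define q where "q n x = (\<phi> (x + h n *\<^sub>R b) - \<phi> x) / h n" for n x
  \<comment> \<open>By the mean value theorem the difference quotients are bounded by
    \<open>\<bar>C\<bar>\<close>. They vanish outside this ball because a step with
    \<open>h n \<le> 1\<close> moves a point by at most \<open>norm b\<close>.\<close>
  define w where "w x = \<bar>C\<bar> * indicator (cball 0 (R + norm b)) x" for x :: 'a
  have hlim: "filterlim h (at 0) sequentially"
    unfolding h_def using LIMSEQ_inverse_real_of_nat by (intro filterlim_atI) auto
  have lim: "(\<lambda>n. LINT x|lborel. q n x) \<longlonglongrightarrow> (LINT x|lborel. pderiv_dir \<phi> b x)"
  proof (rule integral_dominated_convergence[where w = w])
    have "emeasure lborel (cball 0 (R + norm b) :: 'a set) < \<infinity>"
      by (intro emeasure_bounded_finite) auto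
    then show "integrable lborel w"
      unfolding w_def by (intro integrable_mult_right) auto
    show "q n \<in> borel_measurable lborel" for n unfolding q_def by measurable
    show "AE x in lborel. (\<lambda>n. q n x) \<longlonglongrightarrow> pderiv_dir \<phi> b x"
    proof (intro AE_I2)
      fix x
      have "((\<lambda>t. (\<phi> (x + t *\<^sub>R b) - \<phi> x) / t) \<longlongrightarrow> pderiv_dir \<phi> b x) (at 0)"
        using C1_line_has_derivative[OF K(1), of x b 0] by (simp add: has_field_derivative_iff)
      from filterlim_compose[OF this hlim] show "(\<lambda>n. q n x) \<longlonglongrightarrow> pderiv_dir \<phi> b x"
        by (simp add: q_def)
    qed
    show "AE x in lborel. norm (q n x) \<le> w x" for n
    proof (intro AE_I2)
      fix x
      obtain z where z: "\<phi> (x + h n *\<^sub>R b) - \<phi> (x + 0 *\<^sub>R b) = (h n - 0) * pderiv_dir \<phi> b (x + z *\<^sub>R b)"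
        using MVT2[OF h(1)[of n], of "\<lambda>t. \<phi> (x + t *\<^sub>R b)" "\<lambda>t. pderiv_dir \<phi> b (x + t *\<^sub>R b)"]
          C1_line_has_derivative[OF K(1), of x b] by blast
      then have "q n x = pderiv_dir \<phi> b (x + z *\<^sub>R b)" using h(1)[of n] by (simp add: q_def)
      then have 1: "\<bar>q n x\<bar> \<le> \<bar>C\<bar>" using C' by simp
      show "norm (q n x) \<le> w x"
      proof (cases "x \<in> cball 0 (R + norm b)")
        case True then show ?thesis using 1 by (simp add: w_def)
      next
        case False
        then have x: "norm x > R + norm b" by simp
        have "h n * norm b \<le> norm b" using h[of n] by (intro mult_left_le_one_le) auto
        then have "norm (h n *\<^sub>R b) \<le> norm b" using h(1)[of n] by simp
        with x norm_diff_ineq[of x "h n *\<^sub>R b"] have "norm (x + h n *\<^sub>R b) > R" by linarith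
        with R have "x + h n *\<^sub>R b \<notin> K" by fastforce
        moreover have "x \<notin> K" using R[of x] x norm_ge_zero[of b] by linarith
        ultimately show ?thesis using K(3) by (simp add: q_def w_def)
      qed
    qed
  qed auto
  have int: "integrable lborel \<phi>"
    using testC1_sqint(3)[OF open_UNIV assms] by (simp add: integrable_completion)
  have "(LINT x|lborel. q n x) = 0" for n
  proof -
    have shift: "(LINT x|lborel. \<phi> (x + c)) = (LINT x|lborel. \<phi> x)" "integrable lborel (\<lambda>x. \<phi> (x + c))" for c
    proof -
      have "(LINT x|lborel. \<phi> x) = (LINT x|distr lborel borel ((+) c). \<phi> x)"
        by (simp add: lborel_distr_plus)
      also have "\<dots> = (LINT x|lborel. \<phi> (c + x))" by (intro integral_distr) auto
      finally show "(LINT x|lborel. \<phi> (x + c)) = (LINT x|lborel. \<phi> x)" by (simp add: add.commute)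
      have "integrable (distr lborel borel ((+) c)) \<phi>" using int by (simp add: lborel_distr_plus)
      then show "integrable lborel (\<lambda>x. \<phi> (x + c))"
        by (subst (asm) integrable_distr_eq) (auto simp: add.commute)
    qed
    show ?thesis unfolding q_def using shift[of "h n *\<^sub>R b"] int by simp
  qed
  with lim have "(LINT x|lborel. pderiv_dir \<phi> b x) = 0" by (simp add: LIMSEQ_const_iff)
  then show ?thesis by (subst integral_completion) auto
qed

text \<open>The product of the two functions is again a test function, so its derivative integrates
  to 0; the product rule splits that integral.\<close>

lemma testC1_integral_by_parts:
  fixes \<phi> \<psi> :: "'a::euclidean_space \<Rightarrow> real"
  assumes U: "open U" and \<phi>: "\<phi> \<in> testC1 U" and \<psi>: "\<psi> \<in> testC1 U"
  shows "(LINT x|lebesgue_on U. \<phi> x * pderiv_dir \<psi> b x) = - (LINT x|lebesgue_on U. pderiv_dir \<phi> b x * \<psi> x)"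
proof -
  have C: "C1 \<phi>" "C1 \<psi>" using \<phi> \<psi> unfolding testC1_iff by blast+
  obtain K where K: "K \<subseteq> U" "\<And>x. x \<notin> K \<Longrightarrow> \<psi> x = 0" "\<And>x b. x \<notin> K \<Longrightarrow> pderiv_dir \<psi> b x = 0"
    by (rule testC1E[OF \<psi>]) blast
  have "0 = (LINT x|lebesgue. pderiv_dir (\<lambda>x. \<phi> x * \<psi> x) b x)"
    using integral_pderiv_dir_eq_0[OF testC1_mult_C1[OF \<psi> C(1)]] by simp
  also have "\<dots> = (LINT x|lebesgue. \<phi> x * pderiv_dir \<psi> b x + pderiv_dir \<phi> b x * \<psi> x)"
    by (simp add: C1_mult(2)[OF C])
  also have "\<dots> = (LINT x|lebesgue. indicator U x *\<^sub>R (\<phi> x * pderiv_dir \<psi> b x + pderiv_dir \<phi> b x * \<psi> x))"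
  proof (intro Bochner_Integration.integral_cong refl)
    show "\<phi> x * pderiv_dir \<psi> b x + pderiv_dir \<phi> b x * \<psi> x
      = indicator U x *\<^sub>R (\<phi> x * pderiv_dir \<psi> b x + pderiv_dir \<phi> b x * \<psi> x)" for x
      using K(1) K(2,3)[of x] by (cases "x \<in> K") auto
  qed
  also have "\<dots> = (LINT x|lebesgue_on U. \<phi> x * pderiv_dir \<psi> b x + pderiv_dir \<phi> b x * \<psi> x)"
    using U by (simp add: integral_restrict_space)
  also have "\<dots> = (LINT x|lebesgue_on U. \<phi> x * pderiv_dir \<psi> b x) + (LINT x|lebesgue_on U. pderiv_dir \<phi> b x * \<psi> x)"
    by (intro Bochner_Integration.integral_add sqint_mult_integrable testC1_sqint[OF U \<phi>] testC1_sqint[OF U \<psi>])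
  finally show ?thesis by simp
qed

section \<open>Weak gradients as square-integrable fields\<close>

lemma is_weak_grad_iff:
  assumes "open U"
  shows "is_weak_grad U u G \<longleftrightarrow> (\<forall>\<phi>\<in>testC1 U. \<forall>b\<in>Basis.
    (LINT x|lebesgue_on U. u x * pderiv_dir \<phi> b x) = - (LINT x|lebesgue_on U. (G x \<bullet> b) * \<phi> x))"
  by (simp add: is_weak_grad_def set_lint_eq_restrict[OF assms])

lemma is_weak_gradD:
  assumes "is_weak_grad U u G" "open U" "\<phi> \<in> testC1 U" "b \<in> Basis"
  shows "(LINT x|lebesgue_on U. u x * pderiv_dir \<phi> b x) = - (LINT x|lebesgue_on U. (G x \<bullet> b) * \<phi> x)"
  using assms(1,3,4) unfolding is_weak_grad_iff[OF assms(2)] by (elim ballE) auto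

definition sqint_field :: "'a measure \<Rightarrow> ('a \<Rightarrow> 'b::euclidean_space) \<Rightarrow> bool" where
  "sqint_field M G \<longleftrightarrow> (\<forall>b\<in>Basis. sqint M (\<lambda>x. G x \<bullet> b))"

lemma sqint_fieldD: "sqint_field M G \<Longrightarrow> b \<in> Basis \<Longrightarrow> sqint M (\<lambda>x. G x \<bullet> b)"
  by (simp add: sqint_field_def)

lemma is_weak_grad_add_scaled:
  assumes U: "open U" and u: "sqint (lebesgue_on U) u" "sqint (lebesgue_on U) v"
    and G: "sqint_field (lebesgue_on U) G"
      "sqint_field (lebesgue_on U) H"
    and w: "is_weak_grad U u G" "is_weak_grad U v H"
  shows "is_weak_grad U (\<lambda>x. u x + c * v x) (\<lambda>x. G x + c *\<^sub>R H x)"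
  unfolding is_weak_grad_iff[OF U]
proof (intro ballI)
  fix \<phi> and b :: 'a assume \<phi>: "\<phi> \<in> testC1 U" and b: "b \<in> Basis"
  note t = testC1_sqint[OF U \<phi>]
  have "(LINT x|lebesgue_on U. (u x + c * v x) * pderiv_dir \<phi> b x)
      = (LINT x|lebesgue_on U. u x * pderiv_dir \<phi> b x) + c * (LINT x|lebesgue_on U. v x * pderiv_dir \<phi> b x)"
    using sqint_mult_integrable[OF u(1) t(2)] sqint_mult_integrable[OF u(2) t(2)]
    by (simp add: distrib_right mult.assoc)
  also have "\<dots> = - (LINT x|lebesgue_on U. (G x \<bullet> b) * \<phi> x) - c * (LINT x|lebesgue_on U. (H x \<bullet> b) * \<phi> x)"
    using is_weak_gradD[OF w(1) U \<phi> b] is_weak_gradD[OF w(2) U \<phi> b] by simp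
  also have "\<dots> = - (LINT x|lebesgue_on U. ((G x + c *\<^sub>R H x) \<bullet> b) * \<phi> x)"
    using sqint_mult_integrable[OF sqint_fieldD[OF G(1) b] t(1)] sqint_mult_integrable[OF sqint_fieldD[OF G(2) b] t(1)]
    by (simp add: distrib_right mult.assoc inner_add_left)
  finally show "(LINT x|lebesgue_on U. (u x + c * v x) * pderiv_dir \<phi> b x)
    = - (LINT x|lebesgue_on U. ((G x + c *\<^sub>R H x) \<bullet> b) * \<phi> x)" .
qed

text \<open>Each component of the difference is orthogonal to all test functions, so the fundamental
  lemma applies componentwise. This is what makes the \<open>SOME\<close> in \<open>wgrad\<close>
  harmless.\<close>

lemma is_weak_grad_unique:
  fixes G H :: "'a::euclidean_space \<Rightarrow> 'a"
  assumes U: "open U"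
    and G: "sqint_field (lebesgue_on U) G"
      "sqint_field (lebesgue_on U) H"
    and w: "is_weak_grad U u G" "is_weak_grad U u H"
  shows "AE x in lebesgue_on U. G x = H x"
proof -
  have "AE x in lebesgue_on U. G x \<bullet> b - H x \<bullet> b = 0" if b: "b \<in> Basis" for b
  proof (rule testC1_orthogonal_imp_AE_0[OF U sqint_diff[OF sqint_fieldD[OF G(1) b] sqint_fieldD[OF G(2) b]]])
    fix \<phi> assume \<phi>: "\<phi> \<in> testC1 U"
    note t = testC1_sqint(1)[OF U \<phi>]
    have "(LINT x|lebesgue_on U. (G x \<bullet> b) * \<phi> x) = (LINT x|lebesgue_on U. (H x \<bullet> b) * \<phi> x)"
      using is_weak_gradD[OF w(1) U \<phi> b] is_weak_gradD[OF w(2) U \<phi> b] by simp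
    then show "(LINT x|lebesgue_on U. (G x \<bullet> b - H x \<bullet> b) * \<phi> x) = 0"
      using sqint_mult_integrable[OF sqint_fieldD[OF G(1) b] t] sqint_mult_integrable[OF sqint_fieldD[OF G(2) b] t]
      by (simp add: left_diff_distrib)
  qed
  then have "AE x in lebesgue_on U. \<forall>b\<in>Basis. G x \<bullet> b - H x \<bullet> b = 0"
    by (subst AE_ball_countable) (auto intro: countable_finite)
  then show ?thesis
    by eventually_elim (auto intro: euclidean_eqI)
qed

text \<open>Unlike \<open>wgrad\<close>, the field \<open>G\<close> below is explicit; by uniqueness of weak gradients it may replace
  \<open>wgrad U u\<close> in \<open>dir\<close>.\<close>

definition H10_grad :: "'a::euclidean_space set \<Rightarrow> ('a \<Rightarrow> real) \<Rightarrow> ('a \<Rightarrow> 'a) \<Rightarrow> bool" where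
  "H10_grad U u G \<longleftrightarrow> sqint (lebesgue_on U) u \<and> sqint_field (lebesgue_on U) G \<and>
    (\<exists>\<phi>. (\<forall>k. \<phi> k \<in> testC1 U) \<and> (\<lambda>k. sqnorm (lebesgue_on U) (\<lambda>x. \<phi> k x - u x)) \<longlonglongrightarrow> 0 \<and>
      (\<forall>b\<in>Basis. (\<lambda>k. sqnorm (lebesgue_on U) (\<lambda>x. pderiv_dir (\<phi> k) b x - G x \<bullet> b)) \<longlonglongrightarrow> 0))"

text \<open>Integration by parts holds for the approximating test functions, and both of its sides
  are continuous under L2 convergence.\<close>

lemma H10_grad_imp_weak_grad:
  assumes U: "open U" and "H10_grad U u G"
  shows "is_weak_grad U u G"
  unfolding is_weak_grad_iff[OF U]
proof (intro ballI)
  fix \<psi> and b :: 'a assume \<psi>: "\<psi> \<in> testC1 U" and b: "b \<in> Basis"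
  obtain \<phi> where \<phi>: "sqint (lebesgue_on U) u"
    "sqint_field (lebesgue_on U) G"
    "\<And>k. \<phi> k \<in> testC1 U" "(\<lambda>k. sqnorm (lebesgue_on U) (\<lambda>x. \<phi> k x - u x)) \<longlonglongrightarrow> 0"
    "\<And>b. b \<in> Basis \<Longrightarrow> (\<lambda>k. sqnorm (lebesgue_on U) (\<lambda>x. pderiv_dir (\<phi> k) b x - G x \<bullet> b)) \<longlonglongrightarrow> 0"
    using assms(2) unfolding H10_grad_def by (elim conjE exE) (rule that; (assumption | erule spec | erule (1) bspec))
  have 1: "(\<lambda>k. LINT x|lebesgue_on U. \<phi> k x * pderiv_dir \<psi> b x) \<longlonglongrightarrow> (LINT x|lebesgue_on U. u x * pderiv_dir \<psi> b x)"
    by (intro sqint_integral_tendsto \<phi>(1,4) testC1_sqint(1)[OF U \<phi>(3)] testC1_sqint(2)[OF U \<psi>])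
  have "(\<lambda>k. LINT x|lebesgue_on U. pderiv_dir (\<phi> k) b x * \<psi> x) \<longlonglongrightarrow> (LINT x|lebesgue_on U. (G x \<bullet> b) * \<psi> x)"
    by (intro sqint_integral_tendsto sqint_fieldD[OF \<phi>(2) b] \<phi>(5)[OF b] testC1_sqint(2)[OF U \<phi>(3)] testC1_sqint(1)[OF U \<psi>])
  from tendsto_minus[OF this]
  have "(\<lambda>k. LINT x|lebesgue_on U. \<phi> k x * pderiv_dir \<psi> b x) \<longlonglongrightarrow> - (LINT x|lebesgue_on U. (G x \<bullet> b) * \<psi> x)"
    by (simp add: testC1_integral_by_parts[OF U \<phi>(3) \<psi>])
  with 1 show "(LINT x|lebesgue_on U. u x * pderiv_dir \<psi> b x) = - (LINT x|lebesgue_on U. (G x \<bullet> b) * \<psi> x)"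
    using LIMSEQ_unique by blast
qed

text \<open>One square-integrable weak gradient is enough for the choice to return a genuine one,
  and uniqueness then identifies the two up to a null set.\<close>

lemma wgrad_spec:
  assumes U: "open U" and "is_weak_grad U u G" "sqint_field (lebesgue_on U) G"
  shows "is_weak_grad U u (wgrad U u)" "sqint_field (lebesgue_on U) (wgrad U u)"
    "AE x in lebesgue_on U. wgrad U u x = G x"
proof -
  have *: "is_weak_grad U u (wgrad U u) \<and> (\<forall>b\<in>Basis. L2 U (\<lambda>x. wgrad U u x \<bullet> b))"
    unfolding wgrad_def by (rule someI[of _ G]) (use assms L2_iff_sqint[OF U] in \<open>auto simp: sqint_field_def\<close>)
  then show 1: "is_weak_grad U u (wgrad U u)" and
    2: "sqint_field (lebesgue_on U) (wgrad U u)"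
    by (auto simp: L2_iff_sqint[OF U] sqint_field_def)
  show "AE x in lebesgue_on U. wgrad U u x = G x"
    using is_weak_grad_unique[OF U 2 assms(3) 1 assms(2)] .
qed

lemma dir_eq_weak_grad:
  assumes U: "open U"
    and G: "is_weak_grad U u G" "sqint_field (lebesgue_on U) G"
    and H: "is_weak_grad U v H" "sqint_field (lebesgue_on U) H"
  shows "dir U u v = (\<Sum>b\<in>Basis. LINT x|lebesgue_on U. (G x \<bullet> b) * (H x \<bullet> b))"
proof -
  note wG = wgrad_spec[OF U G] and wH = wgrad_spec[OF U H]
  have "dir U u v = (LINT x|lebesgue_on U. (\<Sum>b\<in>Basis. (wgrad U u x \<bullet> b) * (wgrad U v x \<bullet> b)))"
    unfolding dir_def set_lint_eq_restrict[OF U] by (subst euclidean_inner) simp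
  also have "\<dots> = (\<Sum>b\<in>Basis. LINT x|lebesgue_on U. (wgrad U u x \<bullet> b) * (wgrad U v x \<bullet> b))"
    by (intro Bochner_Integration.integral_sum sqint_mult_integrable sqint_fieldD[OF wG(2)] sqint_fieldD[OF wH(2)])
  also have "\<dots> = (\<Sum>b\<in>Basis. LINT x|lebesgue_on U. (G x \<bullet> b) * (H x \<bullet> b))"
  proof (intro sum.cong refl integral_cong_AE)
    fix b :: 'a assume b: "b \<in> Basis"
    show "AE x in lebesgue_on U. (wgrad U u x \<bullet> b) * (wgrad U v x \<bullet> b) = (G x \<bullet> b) * (H x \<bullet> b)"
      using wG(3) wH(3) by eventually_elim simp
    show "(\<lambda>x. (wgrad U u x \<bullet> b) * (wgrad U v x \<bullet> b)) \<in> borel_measurable (lebesgue_on U)"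
      using sqint_mult_integrable[OF sqint_fieldD[OF wG(2) b] sqint_fieldD[OF wH(2) b]] by simp
    show "(\<lambda>x. (G x \<bullet> b) * (H x \<bullet> b)) \<in> borel_measurable (lebesgue_on U)"
      using sqint_mult_integrable[OF sqint_fieldD[OF G(2) b] sqint_fieldD[OF H(2) b]] by simp
  qed
  finally show ?thesis .
qed

lemma testC1_weak_grad:
  fixes \<phi> :: "'a::euclidean_space \<Rightarrow> real"
  assumes U: "open U" and \<phi>: "\<phi> \<in> testC1 U"
  defines "D \<equiv> \<lambda>x. \<Sum>b\<in>Basis. pderiv_dir \<phi> b x *\<^sub>R b"
  shows "is_weak_grad U \<phi> D" "b \<in> Basis \<Longrightarrow> D x \<bullet> b = pderiv_dir \<phi> b x"
proof -
  show *: "b \<in> Basis \<Longrightarrow> D x \<bullet> b = pderiv_dir \<phi> b x" for x b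
    unfolding D_def by (rule inner_sum_left_Basis)
  show "is_weak_grad U \<phi> D" unfolding is_weak_grad_iff[OF U]
    using testC1_integral_by_parts[OF U \<phi>] by (simp add: *)
qed

text \<open>Weak gradients subtract, so the H^1 distance splits into a nonnegative L2 contribution
  of the function and one of each gradient component.\<close>

lemma H1_normsq_test_diff:
  assumes U: "open U" and \<phi>: "\<phi> \<in> testC1 U" and u: "sqint (lebesgue_on U) u"
    and G: "is_weak_grad U u G" "sqint_field (lebesgue_on U) G"
  shows "H1_normsq U (\<lambda>x. \<phi> x - u x) = sqnorm (lebesgue_on U) (\<lambda>x. \<phi> x - u x)
    + (\<Sum>b\<in>Basis. sqnorm (lebesgue_on U) (\<lambda>x. pderiv_dir \<phi> b x - G x \<bullet> b))"
proof -
  let ?D = "\<lambda>x. \<Sum>b\<in>Basis. pderiv_dir \<phi> b x *\<^sub>R b"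
  note D = testC1_weak_grad[OF U \<phi>]
  note sD = testC1_sqint[OF U \<phi>]
  let ?W = "\<lambda>x. ?D x + (-1) *\<^sub>R G x"
  have W: "is_weak_grad U (\<lambda>x. \<phi> x + (-1) * u x) ?W"
    by (rule is_weak_grad_add_scaled[OF U sD(1) u _ G(2) D(1) G(1)]) (simp add: D(2) sD(2) sqint_field_def)
  have WB: "?W x \<bullet> b = pderiv_dir \<phi> b x - G x \<bullet> b" if "b \<in> Basis" for x b
    using D(2)[OF that] by (simp add: inner_diff_left)
  have sW: "sqint_field (lebesgue_on U) ?W" unfolding sqint_field_def
  proof
    show "sqint (lebesgue_on U) (\<lambda>x. ?W x \<bullet> b)" if b: "b \<in> Basis" for b
      using sqint_diff[OF sD(2)[of b] sqint_fieldD[OF G(2) b]] by (simp only: WB[OF b])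
  qed
  have "dir U (\<lambda>x. \<phi> x + (-1) * u x) (\<lambda>x. \<phi> x + (-1) * u x)
      = (\<Sum>b\<in>Basis. sqnorm (lebesgue_on U) (\<lambda>x. pderiv_dir \<phi> b x - G x \<bullet> b))"
    unfolding dir_eq_weak_grad[OF U W sW W sW] sqnorm_def power2_eq_square
    by (intro sum.cong refl Bochner_Integration.integral_cong) (simp only: WB)
  then show ?thesis
    unfolding H1_normsq_def set_lint_eq_restrict[OF U] by (simp add: sqnorm_def)
qed

text \<open>By the preceding splitting, the H^1 distance tends to 0 exactly when each of its
  finitely many nonnegative parts does.\<close>

lemma H10_iff_H10_grad:
  assumes U: "open U"
  shows "H10 U u \<longleftrightarrow> (\<exists>G. H10_grad U u G)"
proof
  assume "H10 U u"
  then obtain \<phi> where H: "H1 U u" and \<phi>: "\<And>k. \<phi> k \<in> testC1 U" 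
    and lim: "(\<lambda>k. H1_normsq U (\<lambda>x. \<phi> k x - u x)) \<longlonglongrightarrow> 0"
    unfolding H10_def by blast
  from H obtain G where u: "sqint (lebesgue_on U) u" and G: "is_weak_grad U u G"
    "sqint_field (lebesgue_on U) G"
    unfolding H1_def L2_iff_sqint[OF U] sqint_field_def by blast
  note eq = H1_normsq_test_diff[OF U \<phi> u G]
  have nn: "0 \<le> (\<Sum>b\<in>Basis. sqnorm (lebesgue_on U) (\<lambda>x. pderiv_dir (\<phi> k) b x - G x \<bullet> b))" for k
    by (intro sum_nonneg) auto
  have "(\<lambda>k. sqnorm (lebesgue_on U) (\<lambda>x. \<phi> k x - u x)) \<longlonglongrightarrow> 0"
    using lim by (rule tendsto_sandwich[OF _ _ tendsto_const, rotated 2])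
      (auto simp: eq nn intro!: always_eventually)
  moreover have "(\<lambda>k. sqnorm (lebesgue_on U) (\<lambda>x. pderiv_dir (\<phi> k) b x - G x \<bullet> b)) \<longlonglongrightarrow> 0"
    if b: "b \<in> Basis" for b
  proof (rule tendsto_sandwich[OF _ _ tendsto_const lim])
    have "sqnorm (lebesgue_on U) (\<lambda>x. pderiv_dir (\<phi> k) b x - G x \<bullet> b) \<le> H1_normsq U (\<lambda>x. \<phi> k x - u x)" for k
    proof -
      have "sqnorm (lebesgue_on U) (\<lambda>x. pderiv_dir (\<phi> k) b x - G x \<bullet> b)
          \<le> (\<Sum>b\<in>Basis. sqnorm (lebesgue_on U) (\<lambda>x. pderiv_dir (\<phi> k) b x - G x \<bullet> b))"
        using b by (intro member_le_sum) auto
      then show ?thesis unfolding eq using sqnorm_nonneg[of "lebesgue_on U" "\<lambda>x. \<phi> k x - u x"] by linarith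
    qed
    then show "\<forall>\<^sub>F k in sequentially. sqnorm (lebesgue_on U) (\<lambda>x. pderiv_dir (\<phi> k) b x - G x \<bullet> b)
        \<le> H1_normsq U (\<lambda>x. \<phi> k x - u x)" by simp
  qed auto
  ultimately have "H10_grad U u G"
    using u G(2) \<phi> unfolding H10_grad_def by (intro conjI exI[of _ \<phi>]) simp_all
  then show "\<exists>G. H10_grad U u G" by (rule exI[of _ G])
next
  assume "\<exists>G. H10_grad U u G"
  then obtain G where G: "H10_grad U u G" by (rule exE)
  obtain \<phi> where \<phi>: "sqint (lebesgue_on U) u"
    "sqint_field (lebesgue_on U) G"
    "\<And>k. \<phi> k \<in> testC1 U" "(\<lambda>k. sqnorm (lebesgue_on U) (\<lambda>x. \<phi> k x - u x)) \<longlonglongrightarrow> 0"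
    "\<And>b. b \<in> Basis \<Longrightarrow> (\<lambda>k. sqnorm (lebesgue_on U) (\<lambda>x. pderiv_dir (\<phi> k) b x - G x \<bullet> b)) \<longlonglongrightarrow> 0"
    using G unfolding H10_grad_def by (elim conjE exE) (rule that; (assumption | erule spec | erule (1) bspec))
  note w = H10_grad_imp_weak_grad[OF U G]
  have "(\<lambda>k. H1_normsq U (\<lambda>x. \<phi> k x - u x)) \<longlonglongrightarrow> 0 + (\<Sum>b\<in>(Basis::'a set). 0)"
    unfolding H1_normsq_test_diff[OF U \<phi>(3,1) w \<phi>(2)]
    by (intro tendsto_add tendsto_sum \<phi>(4,5))
  then have "(\<lambda>k. H1_normsq U (\<lambda>x. \<phi> k x - u x)) \<longlonglongrightarrow> 0" by simp
  moreover have "H1 U u" using w \<phi>(1,2) unfolding H1_def L2_iff_sqint[OF U] sqint_field_def by blast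
  ultimately show "H10 U u" unfolding H10_def using \<phi>(3) by (intro conjI exI[of _ \<phi>]) simp_all
qed

lemma dir_H10_grad:
  assumes U: "open U" and "H10_grad U u G" "H10_grad U v H"
  shows "dir U u v = (\<Sum>b\<in>Basis. LINT x|lebesgue_on U. (G x \<bullet> b) * (H x \<bullet> b))"
  using assms by (intro dir_eq_weak_grad H10_grad_imp_weak_grad) (simp_all add: H10_grad_def)

lemma H10_grad_add_scaled:
  assumes U: "open U" and "H10_grad U u G" "H10_grad U v H"
  shows "H10_grad U (\<lambda>x. u x + c * v x) (\<lambda>x. G x + c *\<^sub>R H x)"
proof -
  let ?M = "lebesgue_on U"
  obtain \<phi> where \<phi>: "sqint ?M u" "sqint_field ?M G"
    "\<And>k. \<phi> k \<in> testC1 U" "(\<lambda>k. sqnorm ?M (\<lambda>x. \<phi> k x - u x)) \<longlonglongrightarrow> 0"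
    "\<And>b. b \<in> Basis \<Longrightarrow> (\<lambda>k. sqnorm ?M (\<lambda>x. pderiv_dir (\<phi> k) b x - G x \<bullet> b)) \<longlonglongrightarrow> 0"
    using assms(2) unfolding H10_grad_def by (elim conjE exE) (rule that; (assumption | erule spec | erule (1) bspec))
  obtain \<psi> where \<psi>: "sqint ?M v" "sqint_field ?M H"
    "\<And>k. \<psi> k \<in> testC1 U" "(\<lambda>k. sqnorm ?M (\<lambda>x. \<psi> k x - v x)) \<longlonglongrightarrow> 0"
    "\<And>b. b \<in> Basis \<Longrightarrow> (\<lambda>k. sqnorm ?M (\<lambda>x. pderiv_dir (\<psi> k) b x - H x \<bullet> b)) \<longlonglongrightarrow> 0"
    using assms(3) unfolding H10_grad_def by (elim conjE exE) (rule that; (assumption | erule spec | erule (1) bspec))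
  let ?\<theta> = "\<lambda>k x. \<phi> k x + c * \<psi> k x"
  have C: "C1 (\<phi> k)" "C1 (\<psi> k)" for k using \<phi>(3) \<psi>(3) unfolding testC1_iff by blast+
  have scaled: "(\<lambda>k. sqnorm ?M (\<lambda>x. p k x + c * q k x)) \<longlonglongrightarrow> 0"
    if "\<And>k. sqint ?M (p k)" "\<And>k. sqint ?M (q k)" "(\<lambda>k. sqnorm ?M (p k)) \<longlonglongrightarrow> 0" "(\<lambda>k. sqnorm ?M (q k)) \<longlonglongrightarrow> 0"
    for p q
    using that tendsto_mult_left[OF that(4), of "c\<^sup>2"]
    by (intro sqnorm_tendsto_0_add sqint_cmult) (auto simp: sqnorm_cmult)
  have "?\<theta> k \<in> testC1 U" for k by (intro testC1_add testC1_cmult \<phi>(3) \<psi>(3))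
  moreover have "(\<lambda>k. sqnorm ?M (\<lambda>x. ?\<theta> k x - (u x + c * v x))) \<longlonglongrightarrow> 0"
    using scaled[OF sqint_diff[OF testC1_sqint(1)[OF U \<phi>(3)] \<phi>(1)] sqint_diff[OF testC1_sqint(1)[OF U \<psi>(3)] \<psi>(1)] \<phi>(4) \<psi>(4)]
    by (simp add: algebra_simps)
  moreover have "(\<lambda>k. sqnorm ?M (\<lambda>x. pderiv_dir (?\<theta> k) b x - (G x + c *\<^sub>R H x) \<bullet> b)) \<longlonglongrightarrow> 0" if b: "b \<in> Basis" for b
    using scaled[OF sqint_diff[OF testC1_sqint(2)[OF U \<phi>(3)] sqint_fieldD[OF \<phi>(2) b]] 
        sqint_diff[OF testC1_sqint(2)[OF U \<psi>(3)] sqint_fieldD[OF \<psi>(2) b]] \<phi>(5)[OF b] \<psi>(5)[OF b]]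
    by (simp add: algebra_simps C1_add(2)[OF C(1) C1_cmult(1)[OF C(2)]] C1_cmult(2)[OF C(2)])
  moreover have "sqint ?M (\<lambda>x. u x + c * v x)" by (intro sqint_add sqint_cmult \<phi> \<psi>)
  moreover have "sqint_field ?M (\<lambda>x. G x + c *\<^sub>R H x)" unfolding sqint_field_def
  proof
    fix b :: 'a assume b: "b \<in> Basis"
    show "sqint ?M (\<lambda>x. (G x + c *\<^sub>R H x) \<bullet> b)" using sqint_add[OF sqint_fieldD[OF \<phi>(2) b] sqint_cmult[OF sqint_fieldD[OF \<psi>(2) b], of c]] by (simp add: inner_add_left)
  qed
  ultimately show ?thesis unfolding H10_grad_def by (intro conjI exI[of _ ?\<theta>]) simp_all
qed

lemma testC1_H10_grad:
  assumes U: "open U" and \<phi>: "\<phi> \<in> testC1 U"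
  shows "H10_grad U \<phi> (\<lambda>x. \<Sum>b\<in>Basis. pderiv_dir \<phi> b x *\<^sub>R b)"
  unfolding H10_grad_def
  using testC1_sqint[OF U \<phi>] \<phi> by (intro conjI exI[of _ "\<lambda>k. \<phi>"]) (auto simp: testC1_weak_grad(2)[OF U \<phi>] sqnorm_def sqint_field_def)

section \<open>Tensor products\<close>

lemma tens_apply [simp]: "tens r s (x, y) = r x * s y"
  by (simp add: tens_def)

lemma tens_eq: "tens r s = (\<lambda>z. r (fst z) * s (snd z))"
  by (simp add: tens_def fun_eq_iff split_beta)

text \<open>The cylinder over a null set is null, by Fubini.\<close>

lemma AE_lborel_fst:
  fixes P :: "'a::euclidean_space \<Rightarrow> bool"
  assumes "AE x in lborel. P x"
  shows "AE z in (lborel :: ('a \<times> 'b::euclidean_space) measure). P (fst z)"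
proof -
  obtain N where N: "N \<in> null_sets lborel" "{x. \<not> P x} \<subseteq> N"
    using assms unfolding eventually_ae_filter by auto
  have [measurable]: "N \<in> sets borel" using N(1) by auto
  have "AE z in (lborel \<Otimes>\<^sub>M lborel :: ('a \<times> 'b) measure). fst z \<notin> N"
  proof (rule lborel_pair.AE_pair_measure)
    have "AE x in lborel. x \<notin> N" using N(1) by (rule AE_not_in)
    then show "AE x in lborel. AE y in (lborel :: 'b measure). fst (x, y) \<notin> N"
      by eventually_elim simp
  qed measurable
  then have "AE z in (lborel :: ('a \<times> 'b) measure). fst z \<notin> N" unfolding lborel_prod .
  then show ?thesis by eventually_elim (use N(2) in blast)
qed

lemma AE_lborel_snd:
  fixes P :: "'b::euclidean_space \<Rightarrow> bool"
  assumes "AE x in lborel. P x"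
  shows "AE z in (lborel :: ('a::euclidean_space \<times> 'b) measure). P (snd z)"
proof -
  obtain N where N: "N \<in> null_sets lborel" "{x. \<not> P x} \<subseteq> N"
    using assms unfolding eventually_ae_filter by auto
  have [measurable]: "N \<in> sets borel" using N(1) by auto
  have "AE z in (lborel \<Otimes>\<^sub>M lborel :: ('a \<times> 'b) measure). snd z \<notin> N"
  proof (rule lborel_pair.AE_pair_measure)
    show "AE x in (lborel :: 'a measure). AE y in lborel. snd (x, y) \<notin> N"
      using AE_not_in[OF N(1)] by simp
  qed measurable
  then have "AE z in (lborel :: ('a \<times> 'b) measure). snd z \<notin> N" unfolding lborel_prod .
  then show ?thesis by eventually_elim (use N(2) in blast)
qed

lemma lborel_integral_tens:
  fixes a b :: "real \<Rightarrow> real"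
  assumes a: "integrable lborel a" and b: "integrable lborel b"
  shows "integrable lborel (tens a b)" "(LINT z|lborel. tens a b z) = (LINT x|lborel. a x) * (LINT y|lborel. b y)"
proof -
  have [measurable]: "a \<in> borel_measurable borel" "b \<in> borel_measurable borel"
    using a b by auto
  have int: "integrable (lborel \<Otimes>\<^sub>M lborel) (tens a b)"
  proof (rule lborel_pair.Fubini_integrable)
    show "tens a b \<in> borel_measurable (lborel \<Otimes>\<^sub>M lborel)" unfolding tens_eq by measurable
    show "integrable lborel (\<lambda>x. LINT y|lborel. norm (tens a b (x, y)))"
      using a by (simp add: abs_mult)
    show "AE x in lborel. integrable lborel (\<lambda>y. tens a b (x, y))" using b by simp
  qed
  then show "integrable lborel (tens a b)" by (simp add: lborel_prod)
  show "(LINT z|lborel. tens a b z) = (LINT x|lborel. a x) * (LINT y|lborel. b y)"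
    using lborel_pair.integral_fst'[OF int] by (simp add: lborel_prod)
qed

text \<open>Lebesgue measure on the plane is the completion of a product measure, whereas Fubini is
  applied to the product itself. Extending by 0 and passing to a Borel representative reaches that
  setting with the same square integral.\<close>

lemma sqint_lebesgue_on_lborel:
  fixes p :: "'a::euclidean_space \<Rightarrow> real"
  assumes "open U" "sqint (lebesgue_on U) p"
  obtains p0 where "p0 \<in> borel_measurable borel" "AE x in lborel. indicator U x * p x = p0 x"
    "integrable lborel (\<lambda>x. (p0 x)\<^sup>2)" "(LINT x|lborel. (p0 x)\<^sup>2) = sqnorm (lebesgue_on U) p"
proof -
  have m: "(\<lambda>x. indicator U x * p x) \<in> borel_measurable lebesgue"
    and i: "integrable lebesgue (\<lambda>x. indicator U x * (p x)\<^sup>2)"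
    using assms by (simp_all add: sqint_def borel_measurable_restrict_space_iff integrable_restrict_space)
  obtain p0 where p0: "p0 \<in> borel_measurable lborel" "AE x in lborel. indicator U x * p x = p0 x"
    using completion_ex_borel_measurable_real[OF m] by blast
  have AE: "AE x in lebesgue. indicator U x * (p x)\<^sup>2 = (p0 x)\<^sup>2"
    using AE_completion[OF p0(2)]
  proof eventually_elim
    case (elim x)
    have "indicator U x * (p x)\<^sup>2 = (indicator U x * p x)\<^sup>2" by (auto simp: indicator_def)
    then show ?case by (simp only: elim)
  qed
  have m0: "(\<lambda>x. (p0 x)\<^sup>2) \<in> borel_measurable lborel" using p0(1) by simp
  note m0' = measurable_completion[OF m0]
  have "integrable lebesgue (\<lambda>x. (p0 x)\<^sup>2)"
    using i AE integrable_cong_AE[OF _ m0' AE] by simp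
  then have "integrable lborel (\<lambda>x. (p0 x)\<^sup>2)" using integrable_completion[OF m0] by simp
  moreover have "(LINT x|lborel. (p0 x)\<^sup>2) = (LINT x|lebesgue. (p0 x)\<^sup>2)"
    using integral_completion[OF m0] by simp
  moreover have "\<dots> = (LINT x|lebesgue. indicator U x * (p x)\<^sup>2)"
    using integral_cong_AE[OF _ m0' AE] i by simp
  moreover have "\<dots> = sqnorm (lebesgue_on U) p"
    using assms(1) by (simp add: sqnorm_def integral_restrict_space)
  ultimately show thesis using p0 by (intro that[of p0]) simp_all
qed

text \<open>The tensor product of Borel representatives represents the tensor product, since the
  exceptional sets are cylinders over null sets; Fubini then gives multiplicativity of the
  norm.\<close>

lemma sqint_tens:
  assumes U: "open U" "open V" and p: "sqint (lebesgue_on U) p" and q: "sqint (lebesgue_on V) q"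
  shows "sqint (lebesgue_on (U \<times> V)) (tens p q)"
    and "sqnorm (lebesgue_on (U \<times> V)) (tens p q) = sqnorm (lebesgue_on U) p * sqnorm (lebesgue_on V) q"
proof -
  obtain p0 where p0: "p0 \<in> borel_measurable borel" "AE x in lborel. indicator U x * p x = p0 x"
    "integrable lborel (\<lambda>x. (p0 x)\<^sup>2)" "(LINT x|lborel. (p0 x)\<^sup>2) = sqnorm (lebesgue_on U) p"
    by (rule sqint_lebesgue_on_lborel[OF U(1) p])
  obtain q0 where q0: "q0 \<in> borel_measurable borel" "AE x in lborel. indicator V x * q x = q0 x"
    "integrable lborel (\<lambda>x. (q0 x)\<^sup>2)" "(LINT x|lborel. (q0 x)\<^sup>2) = sqnorm (lebesgue_on V) q"
    by (rule sqint_lebesgue_on_lborel[OF U(2) q])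
  have [measurable]: "p0 \<in> borel_measurable borel" "q0 \<in> borel_measurable borel" by fact+
  have UV: "open (U \<times> V)" using U by (rule open_Times)
  have "AE z in lborel. indicator (U \<times> V) z * tens p q z = tens p0 q0 z"
    using AE_lborel_fst[OF p0(2), where ?'b = real] AE_lborel_snd[OF q0(2), where ?'a = real]
  proof eventually_elim
    case (elim z)
    then show ?case by (simp add: tens_eq indicator_times flip: elim)
  qed
  then have AE: "AE z in lebesgue. indicator (U \<times> V) z * tens p q z = tens p0 q0 z"
    by (rule AE_completion)
  have "tens p0 q0 \<in> borel_measurable (borel \<Otimes>\<^sub>M borel)" unfolding tens_eq by measurable
  then have tm: "tens p0 q0 \<in> borel_measurable lborel" by (simp add: borel_prod)
  have "(\<lambda>z. indicator (U \<times> V) z * tens p q z) \<in> borel_measurable lebesgue"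
    using measurable_completion[OF tm] by (rule borel_measurable_AE) (use AE in eventually_elim, simp)
  then have m: "tens p q \<in> borel_measurable (lebesgue_on (U \<times> V))"
    using UV by (simp add: borel_measurable_restrict_space_iff)
  have AE2: "AE z in lebesgue. indicator (U \<times> V) z * (tens p q z)\<^sup>2 = (tens p0 q0 z)\<^sup>2"
    using AE
  proof eventually_elim
    case (elim z)
    have "indicator (U \<times> V) z * (tens p q z)\<^sup>2 = (indicator (U \<times> V) z * tens p q z)\<^sup>2"
      by (auto simp: indicator_def)
    then show ?case by (simp only: elim)
  qed
  have sq: "(\<lambda>z. (tens p0 q0 z)\<^sup>2) = tens (\<lambda>x. (p0 x)\<^sup>2) (\<lambda>x. (q0 x)\<^sup>2)"
    by (simp add: tens_eq fun_eq_iff power_mult_distrib)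
  note prod = lborel_integral_tens[OF p0(3) q0(3), folded sq]
  have tm2: "(\<lambda>z. (tens p0 q0 z)\<^sup>2) \<in> borel_measurable lborel" using tm by simp
  note tm2' = measurable_completion[OF tm2]
  have m2: "(\<lambda>z. indicator (U \<times> V) z * (tens p q z)\<^sup>2) \<in> borel_measurable lebesgue"
    using tm2' by (rule borel_measurable_AE) (use AE2 in eventually_elim, simp)
  have "integrable lebesgue (\<lambda>z. (tens p0 q0 z)\<^sup>2)"
    using prod(1) integrable_completion[OF tm2] by simp
  then have "integrable lebesgue (\<lambda>z. indicator (U \<times> V) z * (tens p q z)\<^sup>2)"
    using integrable_cong_AE[OF m2 tm2' AE2] by simp
  then show "sqint (lebesgue_on (U \<times> V)) (tens p q)"
    using m UV by (simp add: sqint_def integrable_restrict_space)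
  have "sqnorm (lebesgue_on (U \<times> V)) (tens p q) = (LINT z|lebesgue. indicator (U \<times> V) z * (tens p q z)\<^sup>2)"
    using UV by (simp add: sqnorm_def integral_restrict_space)
  also have "\<dots> = (LINT z|lebesgue. (tens p0 q0 z)\<^sup>2)"
    by (rule integral_cong_AE[OF m2 tm2' AE2])
  also have "\<dots> = (LINT z|lborel. (tens p0 q0 z)\<^sup>2)" by (rule integral_completion[OF tm2])
  finally show "sqnorm (lebesgue_on (U \<times> V)) (tens p q) = sqnorm (lebesgue_on U) p * sqnorm (lebesgue_on V) q"
    unfolding prod(2) p0(4) q0(4) .
qed

text \<open>Writing \<open>a b - a' b' = (a - a') (b - b') + (a - a') b' + a' (b - b')\<close> makes
  every summand a tensor product with a factor tending to 0 and no factor that must be bounded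
  separately.\<close>

lemma sqnorm_tens_tendsto_0:
  assumes U: "open U" "open V"
    and a: "\<And>k. sqint (lebesgue_on U) (a k)" "sqint (lebesgue_on U) a'"
      "(\<lambda>k. sqnorm (lebesgue_on U) (\<lambda>x. a k x - a' x)) \<longlonglongrightarrow> 0"
    and b: "\<And>k. sqint (lebesgue_on V) (b k)" "sqint (lebesgue_on V) b'"
      "(\<lambda>k. sqnorm (lebesgue_on V) (\<lambda>x. b k x - b' x)) \<longlonglongrightarrow> 0"
  shows "(\<lambda>k. sqnorm (lebesgue_on (U \<times> V)) (\<lambda>z. tens (a k) (b k) z - tens a' b' z)) \<longlonglongrightarrow> 0"
proof -
  let ?a = "\<lambda>k x. a k x - a' x" and ?b = "\<lambda>k x. b k x - b' x"
  let ?M = "lebesgue_on (U \<times> V)"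
  note da = sqint_diff[OF a(1,2)] and db = sqint_diff[OF b(1,2)]
  have 1: "(\<lambda>k. sqnorm ?M (tens (?a k) (?b k))) \<longlonglongrightarrow> 0"
    unfolding sqint_tens(2)[OF U da db] using tendsto_mult[OF a(3) b(3)] by simp
  have 2: "(\<lambda>k. sqnorm ?M (tens (?a k) b')) \<longlonglongrightarrow> 0"
    unfolding sqint_tens(2)[OF U da b(2)] using tendsto_mult_right[OF a(3)] by simp
  have 3: "(\<lambda>k. sqnorm ?M (tens a' (?b k))) \<longlonglongrightarrow> 0"
    unfolding sqint_tens(2)[OF U a(2) db] using tendsto_mult_left[OF b(3)] by simp
  have "(\<lambda>k. sqnorm ?M (\<lambda>z. tens (?a k) (?b k) z + (tens (?a k) b' z + tens a' (?b k) z))) \<longlonglongrightarrow> 0"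
    by (intro sqnorm_tendsto_0_add sqint_add sqint_tens(1)[OF U] da db a(2) b(2) 1 2 3)
  moreover have "(\<lambda>z. tens (?a k) (?b k) z + (tens (?a k) b' z + tens a' (?b k) z))
      = (\<lambda>z. tens (a k) (b k) z - tens a' b' z)" for k
    by (simp add: tens_eq fun_eq_iff algebra_simps)
  ultimately show ?thesis by simp
qed

section \<open>Gradients of tensor products\<close>

lemma tens_C1:
  assumes "C1 \<phi>" "C1 \<psi>"
  shows "C1 (tens \<phi> \<psi>)" "pderiv_dir (tens \<phi> \<psi>) (1, 0) = tens (pderiv_dir \<phi> 1) \<psi>"
    "pderiv_dir (tens \<phi> \<psi>) (0, 1) = tens \<phi> (pderiv_dir \<psi> 1)"
proof -
  have f: "((\<lambda>z::real\<times>real. \<phi> (fst z)) has_derivative (\<lambda>h. pderiv_dir \<phi> 1 (fst z) * fst h)) (at z)" for z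
    using has_derivative_compose[OF has_derivative_fst[OF has_derivative_ident]
        C1_real_has_derivative[OF assms(1), THEN has_field_derivative_imp_has_derivative], of z UNIV] by simp
  have s: "((\<lambda>z::real\<times>real. \<psi> (snd z)) has_derivative (\<lambda>h. pderiv_dir \<psi> 1 (snd z) * snd h)) (at z)" for z
    using has_derivative_compose[OF has_derivative_snd[OF has_derivative_ident]
        C1_real_has_derivative[OF assms(2), THEN has_field_derivative_imp_has_derivative], of z UNIV] by simp
  note c = C1_pderiv_continuous[OF assms(1), of 1] C1_pderiv_continuous[OF assms(2), of 1]
  have C: "C1 (\<lambda>z::real\<times>real. \<phi> (fst z))" "C1 (\<lambda>z::real\<times>real. \<psi> (snd z))"
  proof -
    have "continuous_on UNIV (\<lambda>z::real\<times>real. pderiv_dir \<phi> 1 (fst z) *\<^sub>R (fst_blinfun :: (real \<times> real) \<Rightarrow>\<^sub>L real))"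
      using continuous_on_compose2[OF c(1) continuous_on_fst[OF continuous_on_id, of UNIV]]
      by (intro continuous_intros) auto
    then show "C1 (\<lambda>z::real\<times>real. \<phi> (fst z))"
      by (rule C1I[rotated]) (use f in \<open>simp add: blinfun.scaleR_left [abs_def]\<close>)
    have "continuous_on UNIV (\<lambda>z::real\<times>real. pderiv_dir \<psi> 1 (snd z) *\<^sub>R (snd_blinfun :: (real \<times> real) \<Rightarrow>\<^sub>L real))"
      using continuous_on_compose2[OF c(2) continuous_on_snd[OF continuous_on_id, of UNIV]]
      by (intro continuous_intros) auto
    then show "C1 (\<lambda>z::real\<times>real. \<psi> (snd z))"
      by (rule C1I[rotated]) (use s in \<open>simp add: blinfun.scaleR_left [abs_def]\<close>)
  qed
  show "C1 (tens \<phi> \<psi>)" unfolding tens_eq by (rule C1_mult(1)[OF C])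
  show "pderiv_dir (tens \<phi> \<psi>) (1, 0) = tens (pderiv_dir \<phi> 1) \<psi>"
    "pderiv_dir (tens \<phi> \<psi>) (0, 1) = tens \<phi> (pderiv_dir \<psi> 1)"
    unfolding tens_eq
    by (simp_all add: fun_eq_iff C1_mult(2)[OF C] pderiv_dir_eqI[OF f] pderiv_dir_eqI[OF s])
qed

lemma tens_testC1:
  assumes "\<phi> \<in> testC1 U" "\<psi> \<in> testC1 V"
  shows "tens \<phi> \<psi> \<in> testC1 (U \<times> V)"
proof -
  obtain K where K: "C1 \<phi>" "compact K" "K \<subseteq> U" "\<And>x. x \<notin> K \<Longrightarrow> \<phi> x = 0"
    by (rule testC1E[OF assms(1)]) blast
  obtain L where L: "C1 \<psi>" "compact L" "L \<subseteq> V" "\<And>x. x \<notin> L \<Longrightarrow> \<psi> x = 0"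
    by (rule testC1E[OF assms(2)]) blast
  show ?thesis
  proof (rule testC1I[OF tens_C1(1)[OF K(1) L(1)] compact_Times[OF K(2) L(2)] Sigma_mono[OF K(3) L(3)]])
    show "tens \<phi> \<psi> z = 0" if "z \<notin> K \<times> L" for z
      using that K(4) L(4) by (cases z) auto
  qed
qed

text \<open>The tensor products of the approximating test functions approximate
  \<open>tens r s\<close>. Each component of their gradient is itself a tensor product of
  L2-convergent factors, so the previous convergence lemma applies to it.\<close>

lemma H10_grad_tens:
  assumes U: "open U" "open V" and r: "H10_grad U r R" and s: "H10_grad V s S"
  shows "H10_grad (U \<times> V) (tens r s) (\<lambda>z. (tens R s z, tens r S z))"
proof -
  obtain \<phi> where \<phi>: "sqint (lebesgue_on U) r" "sqint_field (lebesgue_on U) R"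
    "\<And>k. \<phi> k \<in> testC1 U" "(\<lambda>k. sqnorm (lebesgue_on U) (\<lambda>x. \<phi> k x - r x)) \<longlonglongrightarrow> 0"
    "\<And>b. b \<in> Basis \<Longrightarrow> (\<lambda>k. sqnorm (lebesgue_on U) (\<lambda>x. pderiv_dir (\<phi> k) b x - R x \<bullet> b)) \<longlonglongrightarrow> 0"
    using r unfolding H10_grad_def by (elim conjE exE) (rule that; (assumption | erule spec | erule (1) bspec))
  obtain \<psi> where \<psi>: "sqint (lebesgue_on V) s" "sqint_field (lebesgue_on V) S"
    "\<And>k. \<psi> k \<in> testC1 V" "(\<lambda>k. sqnorm (lebesgue_on V) (\<lambda>x. \<psi> k x - s x)) \<longlonglongrightarrow> 0"
    "\<And>b. b \<in> Basis \<Longrightarrow> (\<lambda>k. sqnorm (lebesgue_on V) (\<lambda>x. pderiv_dir (\<psi> k) b x - S x \<bullet> b)) \<longlonglongrightarrow> 0"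
    using s unfolding H10_grad_def by (elim conjE exE) (rule that; (assumption | erule spec | erule (1) bspec))
  have C: "C1 (\<phi> k)" "C1 (\<psi> k)" for k using \<phi>(3) \<psi>(3) unfolding testC1_iff by blast+
  have RS: "sqint (lebesgue_on U) R" "sqint (lebesgue_on V) S"
    using sqint_fieldD[OF \<phi>(2), of 1] sqint_fieldD[OF \<psi>(2), of 1] by simp_all
  have R: "(\<lambda>k. sqnorm (lebesgue_on U) (\<lambda>x. pderiv_dir (\<phi> k) 1 x - R x)) \<longlonglongrightarrow> 0"
    "(\<lambda>k. sqnorm (lebesgue_on V) (\<lambda>x. pderiv_dir (\<psi> k) 1 x - S x)) \<longlonglongrightarrow> 0"
    using \<phi>(5)[of 1] \<psi>(5)[of 1] by simp_all
  note t\<phi> = testC1_sqint[OF U(1) \<phi>(3)] and t\<psi> = testC1_sqint[OF U(2) \<psi>(3)]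
  have B: "b = (1, 0) \<or> b = (0, 1)" if "b \<in> Basis" for b :: "real \<times> real"
    using that by (auto simp: Basis_prod_def)
  show ?thesis unfolding H10_grad_def
  proof (intro conjI exI[of _ "\<lambda>k. tens (\<phi> k) (\<psi> k)"] allI ballI)
    show "sqint (lebesgue_on (U \<times> V)) (tens r s)" by (rule sqint_tens(1)[OF U \<phi>(1) \<psi>(1)])
    show "sqint_field (lebesgue_on (U \<times> V)) (\<lambda>z. (tens R s z, tens r S z))"
      unfolding sqint_field_def
      using sqint_tens(1)[OF U RS(1) \<psi>(1)] sqint_tens(1)[OF U \<phi>(1) RS(2)] by (auto dest!: B)
    show "tens (\<phi> k) (\<psi> k) \<in> testC1 (U \<times> V)" for k by (rule tens_testC1[OF \<phi>(3) \<psi>(3)])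
    show "(\<lambda>k. sqnorm (lebesgue_on (U \<times> V)) (\<lambda>z. tens (\<phi> k) (\<psi> k) z - tens r s z)) \<longlonglongrightarrow> 0"
      by (rule sqnorm_tens_tendsto_0[OF U t\<phi>(1) \<phi>(1,4) t\<psi>(1) \<psi>(1,4)])
    have 1: "(\<lambda>k. sqnorm (lebesgue_on (U \<times> V)) (\<lambda>z. tens (pderiv_dir (\<phi> k) 1) (\<psi> k) z - tens R s z)) \<longlonglongrightarrow> 0"
      by (rule sqnorm_tens_tendsto_0[OF U t\<phi>(2) RS(1) R(1) t\<psi>(1) \<psi>(1,4)])
    have 2: "(\<lambda>k. sqnorm (lebesgue_on (U \<times> V)) (\<lambda>z. tens (\<phi> k) (pderiv_dir (\<psi> k) 1) z - tens r S z)) \<longlonglongrightarrow> 0"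
      by (rule sqnorm_tens_tendsto_0[OF U t\<phi>(1) \<phi>(1,4) t\<psi>(2) RS(2) R(2)])
    fix b :: "real \<times> real" assume "b \<in> Basis"
    then consider "b = (1, 0)" | "b = (0, 1)" using B by blast
    then show "(\<lambda>k. sqnorm (lebesgue_on (U \<times> V))
        (\<lambda>z. pderiv_dir (tens (\<phi> k) (\<psi> k)) b z - (tens R s z, tens r S z) \<bullet> b)) \<longlonglongrightarrow> 0"
      using 1 2 by cases (simp_all add: tens_C1(2,3)[OF C])
  qed
qed

section \<open>B-spline quasi-interpolation\<close>

text \<open>\<open>bspl\<close> is the quadratic B-spline supported in [0, 3]. It is the backward difference of \<open>qramp\<close>,
  whose derivative \<open>hat\<close> is the backward difference of \<open>ramp\<close>: so the integer shifts of both sum to 1 by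
  telescoping, and summation by parts turns the derivative of a quasi-interpolant into a convex
  combination of difference quotients.\<close>

definition ramp :: "real \<Rightarrow> real" where
  "ramp t = max 0 t - max 0 (t - 1)"

definition qramp :: "real \<Rightarrow> real" where
  "qramp t = ((max 0 t)\<^sup>2 - 2 * (max 0 (t - 1))\<^sup>2 + (max 0 (t - 2))\<^sup>2) / 2"

definition hat :: "real \<Rightarrow> real" where
  "hat t = ramp t - ramp (t - 1)"

definition bspl :: "real \<Rightarrow> real" where
  "bspl t = qramp t - qramp (t - 1)"

lemma hat_nonneg: "0 \<le> hat t"
  by (auto simp: hat_def ramp_def max_def)

lemma hat_eq_0: "t \<le> 0 \<or> t \<ge> 2 \<Longrightarrow> hat t = 0"
  by (auto simp: hat_def ramp_def max_def)

lemma has_real_derivative_affine: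
  fixes f :: "real \<Rightarrow> real"
  assumes "(f has_real_derivative D) (at (t / h - c))"
  shows "((\<lambda>t. f (t / h - c)) has_real_derivative D / h) (at t)"
proof -
  have "((\<lambda>t. t / h - c) has_real_derivative 1 / h) (at t)"
    by (auto intro!: derivative_eq_intros simp: divide_inverse)
  from DERIV_chain2[where f = f and g = "\<lambda>t. t / h - c", OF assms this] show ?thesis by simp
qed

lemma qramp_has_derivative: "(qramp has_real_derivative hat t) (at t)"
proof -
  have *: "((\<lambda>t. (max 0 (t - c))\<^sup>2) has_real_derivative 2 * max 0 (t - c)) (at t)" for c :: real
    using has_real_derivative_affine[of _ _ t 1 c, OF pos_part_power2_has_derivative] by simp
  note DERIV_cdivide[OF DERIV_add[OF DERIV_diff[OF pos_part_power2_has_derivative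
          DERIV_cmult[OF *[of 1], of 2]] *[of 2]], of 2]
  then show ?thesis
    unfolding qramp_def [abs_def] by (rule DERIV_cong) (simp add: hat_def ramp_def field_simps)
qed

lemma qramp_low: "t \<le> 0 \<Longrightarrow> qramp t = 0"
  by (simp add: qramp_def)

lemma qramp_high: "t \<ge> 2 \<Longrightarrow> qramp t = 1"
  by (simp add: qramp_def power2_eq_square algebra_simps)

lemma bspl_nonneg: "0 \<le> bspl t"
proof -
  have "qramp (t - 1) \<le> qramp t"
    by (rule DERIV_nonneg_imp_nondecreasing) (use qramp_has_derivative hat_nonneg in auto)
  then show ?thesis by (simp add: bspl_def)
qed

lemma bspl_eq_0: "t \<le> 0 \<or> t \<ge> 3 \<Longrightarrow> bspl t = 0"
  by (auto simp: bspl_def qramp_low qramp_high)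

lemma bspl_has_derivative: "(bspl has_real_derivative hat t - hat (t - 1)) (at t)"
proof -
  have "((\<lambda>t. qramp (t - 1)) has_real_derivative hat (t - 1)) (at t)"
    using has_real_derivative_affine[of _ _ t 1 1, OF qramp_has_derivative] by simp
  then show ?thesis
    unfolding bspl_def [abs_def] by (intro DERIV_diff qramp_has_derivative)
qed

section \<open>Partition of unity and summation by parts\<close>

lemma sum_telescope_int:
  fixes F :: "int \<Rightarrow> real"
  shows "(\<Sum>i\<in>{- int N..int N}. F (i + 1) - F i) = F (int N + 1) - F (- int N)"
proof (induction N)
  case (Suc N)
  have "{- int (Suc N)..int (Suc N)} = insert (- int N - 1) (insert (int N + 1) {- int N..int N})" by auto
  then have "(\<Sum>i\<in>{- int (Suc N)..int (Suc N)}. F (i + 1) - F i)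
      = F (- int N) - F (- int N - 1) + (F (int N + 2) - F (int N + 1) + (\<Sum>i\<in>{- int N..int N}. F (i + 1) - F i))"
    by (simp add: algebra_simps)
  moreover have "F (int (Suc N) + 1) = F (int N + 2)" "F (- int (Suc N)) = F (- int N - 1)"
    by (rule arg_cong[of _ _ F]; simp)+
  ultimately show ?case using Suc by linarith
qed simp

text \<open>Telescoping leaves one value of \<open>ramp\<close> that is already 1 and one that is
  still 0. The margin 2 is where \<open>qramp\<close> saturates; \<open>ramp\<close> saturates at 1,
  but a common margin serves this lemma and the next.\<close>

lemma sum_hat_eq_1:
  assumes "\<bar>t\<bar> \<le> real N - 2"
  shows "(\<Sum>i\<in>{- int N..int N}. hat (t - of_int i)) = 1"
proof -
  have "(\<Sum>i\<in>{- int N..int N}. hat (t - of_int i))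
      = (\<Sum>i\<in>{- int N..int N}. (\<lambda>i. - ramp (t - of_int i)) (i + 1) - (\<lambda>i. - ramp (t - of_int i)) i)"
    by (intro sum.cong refl) (simp add: hat_def algebra_simps)
  also have "\<dots> = ramp (t + real N) - ramp (t - real N - 1)"
    by (subst sum_telescope_int) (simp add: algebra_simps)
  also have "\<dots> = 1" using assms by (auto simp: ramp_def)
  finally show ?thesis .
qed

lemma sum_bspl_eq_1:
  assumes "\<bar>t\<bar> \<le> real N - 2"
  shows "(\<Sum>i\<in>{- int N..int N}. bspl (t - of_int i)) = 1"
proof -
  have "(\<Sum>i\<in>{- int N..int N}. bspl (t - of_int i))
      = (\<Sum>i\<in>{- int N..int N}. (\<lambda>i. - qramp (t - of_int i)) (i + 1) - (\<lambda>i. - qramp (t - of_int i)) i)"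
    by (intro sum.cong refl) (simp add: bspl_def algebra_simps)
  also have "\<dots> = qramp (t + real N) - qramp (t - real N - 1)"
    by (subst sum_telescope_int) (simp add: algebra_simps)
  also have "\<dots> = 1" using assms by (simp add: qramp_low qramp_high)
  finally show ?thesis .
qed

text \<open>Abel summation. The boundary terms carry \<open>c\<close> at \<open>N\<close> and at
  \<open>- N - 1\<close>, which is why vanishing is assumed from index \<open>N\<close> on.\<close>

lemma sum_by_parts_hat:
  fixes c :: "int \<Rightarrow> real"
  assumes "\<And>i. \<bar>i\<bar> \<ge> int N \<Longrightarrow> c i = 0"
  shows "(\<Sum>i\<in>{- int N..int N}. c i * (hat (t - of_int i) - hat (t - of_int i - 1)))
    = (\<Sum>i\<in>{- int N..int N}. (c i - c (i - 1)) * hat (t - of_int i))"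
proof -
  let ?F = "\<lambda>i. c (i - 1) * hat (t - of_int i)"
  have "(\<Sum>i\<in>{- int N..int N}. ?F (i + 1) - ?F i) = 0"
    using sum_telescope_int[of ?F N] assms[of "int N"] assms[of "- int N - 1"] by simp
  then have "(\<Sum>i\<in>{- int N..int N}. c i * hat (t - of_int i - 1)) = (\<Sum>i\<in>{- int N..int N}. ?F i)"
    by (simp add: sum_subtractf algebra_simps)
  then show ?thesis by (simp add: algebra_simps sum_subtractf)
qed

text \<open>Summation by parts moves the difference from the splines to the nodal values. What
  remains is an average of difference quotients with nonnegative weights \<open>hat * bspl\<close>
  of total 1, and only nodes near \<open>(x, y)\<close> have positive weight. The second partial
  derivative follows from the same statement with the arguments of \<open>F\<close>
  exchanged.\<close>

lemma bspl_quasi_interpolant_deriv: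
  fixes F F' :: "real \<Rightarrow> real \<Rightarrow> real"
  assumes h: "h > 0" and F: "\<And>x y. ((\<lambda>x. F x y) has_real_derivative F' x y) (at x)"
    and supp: "\<And>i j. \<bar>i\<bar> \<ge> int N \<Longrightarrow> F (h * of_int i) (h * of_int j) = 0"
    and x: "\<bar>x\<bar> \<le> h * (real N - 2)" and y: "\<bar>y\<bar> \<le> h * (real N - 2)"
    and osc: "\<And>x' y'. \<bar>x' - x\<bar> \<le> 3 * h \<Longrightarrow> \<bar>y' - y\<bar> \<le> 3 * h \<Longrightarrow> \<bar>F' x' y' - F' x y\<bar> \<le> \<epsilon>"
  shows "\<bar>(\<Sum>i\<in>{- int N..int N}. \<Sum>j\<in>{- int N..int N}. F (h * of_int i) (h * of_int j) *
      ((hat (x / h - of_int i) - hat (x / h - of_int i - 1)) / h) * bspl (y / h - of_int j)) - F' x y\<bar> \<le> \<epsilon>"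
proof -
  let ?Z = "{- int N..int N}"
  let ?L = "\<lambda>i. hat (x / h - of_int i)" and ?B = "\<lambda>j. bspl (y / h - of_int j)"
  define d where "d i j = (F (h * of_int i) (h * of_int j) - F (h * of_int (i - 1)) (h * of_int j)) / h" for i j
  have abs: "\<bar>x / h\<bar> \<le> real N - 2" "\<bar>y / h\<bar> \<le> real N - 2"
    using x y h by (simp_all add: abs_div_pos[symmetric] field_simps)
  have one: "(\<Sum>i\<in>?Z. \<Sum>j\<in>?Z. ?L i * ?B j) = 1"
    using sum_hat_eq_1[OF abs(1)] sum_bspl_eq_1[OF abs(2)] by (simp flip: sum_product)
  have "(\<Sum>i\<in>?Z. \<Sum>j\<in>?Z. F (h * of_int i) (h * of_int j) * ((?L i - hat (x / h - of_int i - 1)) / h) * ?B j)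
      = (\<Sum>j\<in>?Z. (\<Sum>i\<in>?Z. F (h * of_int i) (h * of_int j) * (?L i - hat (x / h - of_int i - 1))) * (?B j / h))"
    by (subst sum.swap) (simp add: sum_distrib_right sum_divide_distrib mult.assoc)
  also have "\<dots> = (\<Sum>j\<in>?Z. (\<Sum>i\<in>?Z. (F (h * of_int i) (h * of_int j) - F (h * of_int (i - 1)) (h * of_int j)) * ?L i) * (?B j / h))"
    by (intro sum.cong refl arg_cong2[where f = "(*)"] sum_by_parts_hat supp)
  also have "\<dots> = (\<Sum>i\<in>?Z. \<Sum>j\<in>?Z. d i j * (?L i * ?B j))"
    by (subst sum.swap) (simp add: d_def sum_distrib_right sum_divide_distrib mult.assoc)
  finally have eq: "(\<Sum>i\<in>?Z. \<Sum>j\<in>?Z. F (h * of_int i) (h * of_int j) *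
      ((?L i - hat (x / h - of_int i - 1)) / h) * ?B j) - F' x y
      = (\<Sum>i\<in>?Z. \<Sum>j\<in>?Z. (d i j - F' x y) * (?L i * ?B j))"
    using one by (simp add: left_diff_distrib sum_subtractf flip: sum_distrib_left)
  have bound: "\<bar>(d i j - F' x y) * (?L i * ?B j)\<bar> \<le> \<epsilon> * (?L i * ?B j)" for i j
  proof (cases "?L i * ?B j = 0")
    case False
    then have "x / h - of_int i > 0" "x / h - of_int i < 2" "y / h - of_int j > 0" "y / h - of_int j < 3"
      using hat_eq_0[of "x / h - of_int i"] bspl_eq_0[of "y / h - of_int j"] by force+
    then have near: "h * of_int i < x" "x < h * of_int i + 2 * h" "h * of_int j < y" "y < h * of_int j + 3 * h"
      using h by (simp_all add: field_simps)
    have "h * of_int (i - 1) < h * of_int i" using h by simp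
    from MVT2[OF this, of "\<lambda>x. F x (h * of_int j)" "\<lambda>x. F' x (h * of_int j)"] F
    obtain z where z: "h * of_int (i - 1) < z" "z < h * of_int i"
      "F (h * of_int i) (h * of_int j) - F (h * of_int (i - 1)) (h * of_int j)
        = (h * of_int i - h * of_int (i - 1)) * F' z (h * of_int j)"
      by blast
    have "d i j = F' z (h * of_int j)" using z(3) h by (simp add: d_def algebra_simps)
    \<comment> \<open>A nonzero weight puts the node \<open>h * of_int i\<close> less than
      \<open>2 * h\<close> to the left of \<open>x\<close>, and \<open>z\<close> lies less than one
      further \<open>h\<close> to the left; the support of \<open>bspl\<close> gives the radius
      \<open>3 * h\<close> in the second variable too.\<close>
    moreover have "\<bar>F' z (h * of_int j) - F' x y\<bar> \<le> \<epsilon>"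
      using near z(1,2) h by (intro osc) (auto simp: abs_le_iff algebra_simps)
    ultimately show ?thesis
      using hat_nonneg[of "x / h - of_int i"] bspl_nonneg[of "y / h - of_int j"]
      by (simp add: abs_mult mult_right_mono)
  qed auto
  have "\<bar>\<Sum>i\<in>?Z. \<Sum>j\<in>?Z. (d i j - F' x y) * (?L i * ?B j)\<bar> \<le> (\<Sum>i\<in>?Z. \<Sum>j\<in>?Z. \<epsilon> * (?L i * ?B j))"
    by (intro order.trans[OF sum_abs] sum_mono bound)
  also have "\<dots> = \<epsilon>" using one by (simp flip: sum_distrib_left)
  finally show ?thesis unfolding eq .
qed

section \<open>Tensor-product approximation of test functions\<close>

lemma bspl_scaled_C1:
  fixes h c :: real
  assumes h: "h > 0"
  defines "\<beta> \<equiv> \<lambda>x. bspl (x / h - c)"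
  shows "C1 \<beta>" "pderiv_dir \<beta> 1 x = (hat (x / h - c) - hat (x / h - c - 1)) / h"
proof -
  have 1: "(\<beta> has_real_derivative (hat (x / h - c) - hat (x / h - c - 1)) / h) (at x)" for x
    unfolding \<beta>_def by (rule has_real_derivative_affine[OF bspl_has_derivative])
  have 2: "continuous_on UNIV (\<lambda>x. (hat (x / h - c) - hat (x / h - c - 1)) / h)"
    unfolding hat_def ramp_def using h by (intro continuous_intros) auto
  show "C1 \<beta>" "pderiv_dir \<beta> 1 x = (hat (x / h - c) - hat (x / h - c - 1)) / h"
    by (rule C1_real[OF 1 2])+
qed

text \<open>The support is the one-sided interval from \<open>h * c\<close> to
  \<open>h * c + 3 * h\<close>. The symmetric ball encloses it and fits the margin around the
  support of the function being approximated.\<close>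

lemma bspl_scaled_testC1:
  assumes h: "h > 0" and "cball (h * c) (3 * h) \<subseteq> U"
  shows "(\<lambda>x. bspl (x / h - c)) \<in> testC1 U"
proof (rule testC1I[OF bspl_scaled_C1(1)[OF h] compact_cball assms(2)])
  fix x assume "x \<notin> cball (h * c) (3 * h)"
  then have "x < h * c \<or> x > h * c + 3 * h" using h by (auto simp: dist_real_def abs_if split: if_splits)
  then have "x / h - c \<le> 0 \<or> x / h - c \<ge> 3" using h by (auto simp: field_simps)
  then show "bspl (x / h - c) = 0" by (rule bspl_eq_0)
qed

lemma C1_sum:
  assumes "finite I" "\<And>i. i \<in> I \<Longrightarrow> C1 (\<phi> i)"
  shows "C1 (\<lambda>x. \<Sum>i\<in>I. \<phi> i x) \<and> pderiv_dir (\<lambda>x. \<Sum>i\<in>I. \<phi> i x) b x = (\<Sum>i\<in>I. pderiv_dir (\<phi> i) b x)"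
  using assms
proof (induction I rule: finite_induct)
  case empty
  show ?case using pderiv_dir_eqI[OF has_derivative_const, of 0 b x] by simp
next
  case (insert i I)
  then have "C1 (\<phi> i)" "C1 (\<lambda>x. \<Sum>i\<in>I. \<phi> i x)" by simp_all
  from C1_add[OF this] show ?case using insert by simp
qed

lemma testC1_sum:
  assumes "finite I" "\<And>i. i \<in> I \<Longrightarrow> \<phi> i \<in> testC1 U"
  shows "(\<lambda>x. \<Sum>i\<in>I. \<phi> i x) \<in> testC1 U"
  using assms
proof (induction I rule: finite_induct)
  case (insert i I)
  then have "\<phi> i \<in> testC1 U" "(\<lambda>x. \<Sum>i\<in>I. \<phi> i x) \<in> testC1 U" by simp_all
  from testC1_add[OF this] show ?case using insert by simp
qed simp

lemma dir_testC1:
  assumes U: "open U" and w: "w \<in> testC1 U"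
  shows "dir U w w = (\<Sum>b\<in>Basis. sqnorm (lebesgue_on U) (pderiv_dir w b))"
proof -
  note W = testC1_weak_grad[OF U w] 
  have s: "sqint_field (lebesgue_on U) (\<lambda>x. \<Sum>b\<in>Basis. pderiv_dir w b x *\<^sub>R b)"
    unfolding sqint_field_def using testC1_sqint(2)[OF U w] by (simp add: W(2))
  show ?thesis
    unfolding dir_eq_weak_grad[OF U W(1) s W(1) s]
    by (intro sum.cong refl) (simp add: W(2) sqnorm_def power2_eq_square)
qed

lemma sqnorm_le_bound:
  assumes U: "open U" "bounded U" and w: "sqint (lebesgue_on U) w" and b: "\<And>x. x \<in> U \<Longrightarrow> \<bar>w x\<bar> \<le> \<epsilon>"
  shows "sqnorm (lebesgue_on U) w \<le> \<epsilon>\<^sup>2 * measure lebesgue U"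
proof -
  have U': "U \<in> lmeasurable" using U by (intro bounded_set_imp_lmeasurable) auto
  interpret finite_measure "lebesgue_on U"
    using U' by (rule finite_measure_lebesgue_on)
  have "sqnorm (lebesgue_on U) w \<le> (LINT x|lebesgue_on U. \<epsilon>\<^sup>2)"
    unfolding sqnorm_def
  proof (rule integral_mono)
    show "(w x)\<^sup>2 \<le> \<epsilon>\<^sup>2" if "x \<in> space (lebesgue_on U)" for x
      using power_mono[OF b[of x], of 2] that by simp
  qed (use w in \<open>auto simp: sqint_def\<close>)
  also have "\<dots> = \<epsilon>\<^sup>2 * measure lebesgue U"
    using U by (simp add: measure_restrict_space mult.commute)
  finally show ?thesis .
qed

text \<open>Quasi-interpolation on a grid so fine that the partial derivatives oscillate by at most
  \<open>\<epsilon>\<close> over a stencil and that the splines at nodes in the support of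
  \<open>\<phi>\<close> fit into \<open>U\<close> and \<open>V\<close>.\<close>

lemma testC1_tens_approx_pderiv:
  fixes \<phi> :: "real \<times> real \<Rightarrow> real"
  assumes U: "open U" "bounded U" and V: "open V" "bounded V"
    and \<phi>: "\<phi> \<in> testC1 (U \<times> V)" and \<epsilon>: "\<epsilon> > 0"
  obtains I :: "(int \<times> int) set" and c p q where "finite I"
    "\<And>i. i \<in> I \<Longrightarrow> p i \<in> testC1 U" "\<And>i. i \<in> I \<Longrightarrow> q i \<in> testC1 V"
    "\<And>z b. z \<in> U \<times> V \<Longrightarrow> b \<in> Basis \<Longrightarrow>
       \<bar>pderiv_dir (\<lambda>z. \<Sum>i\<in>I. c i * tens (p i) (q i) z) b z - pderiv_dir \<phi> b z\<bar> \<le> \<epsilon>"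
proof -
  obtain K where K: "C1 \<phi>" "compact K" "K \<subseteq> U \<times> V" "\<And>x. x \<notin> K \<Longrightarrow> \<phi> x = 0"
    by (rule testC1E[OF \<phi>]) blast
  \<comment> \<open>The projections of \<open>K\<close> are compact in the open factors, so each has
    a uniform margin to the complement, in which the spline supports will fit.\<close>
  obtain \<delta>1 where \<delta>1: "\<delta>1 > 0" "(\<Union>x\<in>fst ` K. cball x \<delta>1) \<subseteq> U"
    using compact_subset_open_imp_cball_epsilon_subset[of "fst ` K" U] K(2,3) U(1)
    by (force intro: compact_continuous_image continuous_on_fst[OF continuous_on_id])
  obtain \<delta>2 where \<delta>2: "\<delta>2 > 0" "(\<Union>x\<in>snd ` K. cball x \<delta>2) \<subseteq> V"
    using compact_subset_open_imp_cball_epsilon_subset[of "snd ` K" V] K(2,3) V(1)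
    by (force intro: compact_continuous_image continuous_on_snd[OF continuous_on_id])
  obtain R where R: "R > 0" "\<And>z. z \<in> U \<times> V \<Longrightarrow> norm z < R"
    using bounded_Times[OF U(2) V(2)] unfolding bounded_pos_less by blast
  have R': "\<bar>x\<bar> < R \<and> \<bar>y\<bar> < R" if "(x, y) \<in> U \<times> V" for x y
    using R(2)[OF that] norm_fst_le[of x y] norm_snd_le[of y x] by auto
  \<comment> \<open>The box is enlarged by 1 because derivatives are also compared at stencil points
    that may lie outside \<open>U \<times> V\<close>.\<close>
  let ?Q = "cbox (- (R + 1), - (R + 1)) (R + 1, R + 1) :: (real \<times> real) set"
  have "uniformly_continuous_on ?Q (pderiv_dir \<phi> b)" for b
    by (intro compact_uniformly_continuous continuous_on_subset[OF C1_pderiv_continuous[OF K(1)]]) auto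
  then have "\<exists>d>0. \<forall>x\<in>?Q. \<forall>x'\<in>?Q. dist x' x < d \<longrightarrow> dist (pderiv_dir \<phi> b x') (pderiv_dir \<phi> b x) < \<epsilon>" for b
    using \<epsilon> unfolding uniformly_continuous_on_def by blast
  then obtain D where D: "\<And>b. D b > 0"
    "\<And>b x x'. x \<in> ?Q \<Longrightarrow> x' \<in> ?Q \<Longrightarrow> dist x' x < D b \<Longrightarrow> dist (pderiv_dir \<phi> b x') (pderiv_dir \<phi> b x) < \<epsilon>"
    by metis
  \<comment> \<open>Both coordinates move by at most \<open>3 * h\<close>, hence the point by at
    most \<open>6 * h\<close>; the divisor 7 makes this strictly less than \<open>D b\<close>. It
    also leaves room for the spline supports and for staying inside \<open>?Q\<close>.\<close>
  define h where "h = Min {\<delta>1, \<delta>2, 1, D (1, 0), D (0, 1)} / 7"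
  have hpos: "h > 0" using \<delta>1(1) \<delta>2(1) D(1) by (simp add: h_def)
  have "7 * h \<le> a" if "a \<in> {\<delta>1, \<delta>2, 1, D (1, 0), D (0, 1)}" for a
    using that unfolding h_def by (auto simp: min_le_iff_disj)
  then have h: "7 * h \<le> \<delta>1" "7 * h \<le> \<delta>2" "7 * h \<le> 1" "7 * h \<le> D (1, 0)" "7 * h \<le> D (0, 1)" by simp_all
  \<comment> \<open>With \<open>R \<le> h * (N - 2)\<close> the partitions of unity hold at every
    point of \<open>U \<times> V\<close>, and nodes with an index of size at least \<open>N\<close>
    fall outside the domain, where \<open>\<phi>\<close> is 0.\<close>
  define N where "N = nat \<lceil>R / h\<rceil> + 2"
  have N: "R \<le> h * (real N - 2)"
    using hpos real_nat_ceiling_ge[of "R / h"] by (simp add: N_def pos_divide_le_eq mult.commute)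
  let ?Z = "{- int N..int N}"
  \<comment> \<open>Nodes with a nonzero value lie in \<open>K\<close>, so both of their splines are
    test functions. The discarded nodes carry coefficient 0, so sums over \<open>I\<close> agree
    with sums over the whole square.\<close>
  define I where "I = {(i, j) \<in> ?Z \<times> ?Z. \<phi> (h * of_int i, h * of_int j) \<noteq> 0}"
  define c where "c ij = \<phi> (h * of_int (fst ij), h * of_int (snd ij))" for ij :: "int \<times> int"
  define \<beta> where "\<beta> i x = bspl (x / h - of_int i)" for i :: int and x
  have \<beta>C: "C1 (\<beta> i)" "pderiv_dir (\<beta> i) 1 x = (hat (x / h - of_int i) - hat (x / h - of_int i - 1)) / h" for i x
    using bspl_scaled_C1[OF hpos, of "of_int i"] unfolding \<beta>_def [abs_def] by simp_all
  have fin: "finite I" unfolding I_def by (rule finite_subset[of _ "?Z \<times> ?Z"]) auto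
  have inK: "(h * of_int (fst i), h * of_int (snd i)) \<in> K" if "i \<in> I" for i
    by (rule ccontr) (use that K(4) in \<open>force simp: I_def\<close>)
  have p: "\<beta> (fst i) \<in> testC1 U" if "i \<in> I" for i
    unfolding \<beta>_def [abs_def]
  proof (rule bspl_scaled_testC1[OF hpos])
    have "h * of_int (fst i) \<in> fst ` K" using inK[OF that] by (rule image_eqI[rotated]) simp
    then have "cball (h * of_int (fst i)) \<delta>1 \<subseteq> U" using \<delta>1(2) by blast
    moreover have "cball (h * of_int (fst i)) (3 * h) \<subseteq> cball (h * of_int (fst i)) \<delta>1"
      using h(1) hpos by (intro subset_cball) simp
    ultimately show "cball (h * of_int (fst i)) (3 * h) \<subseteq> U" by blast
  qed
  have q: "\<beta> (snd i) \<in> testC1 V" if "i \<in> I" for i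
    unfolding \<beta>_def [abs_def]
  proof (rule bspl_scaled_testC1[OF hpos])
    have "h * of_int (snd i) \<in> snd ` K" using inK[OF that] by (rule image_eqI[rotated]) simp
    then have "cball (h * of_int (snd i)) \<delta>2 \<subseteq> V" using \<delta>2(2) by blast
    moreover have "cball (h * of_int (snd i)) (3 * h) \<subseteq> cball (h * of_int (snd i)) \<delta>2"
      using h(2) hpos by (intro subset_cball) simp
    ultimately show "cball (h * of_int (snd i)) (3 * h) \<subseteq> V" by blast
  qed
  have pd: "pderiv_dir (\<lambda>z. \<Sum>i\<in>I. c i * tens (\<beta> (fst i)) (\<beta> (snd i)) z) b z
      = (\<Sum>i\<in>?Z. \<Sum>j\<in>?Z. \<phi> (h * of_int i, h * of_int j) * pderiv_dir (tens (\<beta> i) (\<beta> j)) b z)" for b z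
  proof -
    note T = tens_C1(1)[OF \<beta>C(1) \<beta>C(1)]
    have "pderiv_dir (\<lambda>z. \<Sum>i\<in>I. c i * tens (\<beta> (fst i)) (\<beta> (snd i)) z) b z
        = (\<Sum>i\<in>I. c i * pderiv_dir (tens (\<beta> (fst i)) (\<beta> (snd i))) b z)"
      using C1_sum[OF fin C1_cmult(1)[OF T], of c fst snd b z] by (simp add: C1_cmult(2)[OF T])
    also have "\<dots> = (\<Sum>i\<in>?Z \<times> ?Z. c i * pderiv_dir (tens (\<beta> (fst i)) (\<beta> (snd i))) b z)"
      by (intro sum.mono_neutral_left) (auto simp: I_def c_def)
    also have "\<dots> = (\<Sum>i\<in>?Z. \<Sum>j\<in>?Z. \<phi> (h * of_int i, h * of_int j) * pderiv_dir (tens (\<beta> i) (\<beta> j)) b z)"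
      by (simp add: sum.cartesian_product c_def split_beta)
    finally show ?thesis .
  qed
  have far: "\<phi> (h * of_int i, h * of_int j) = 0" if "\<bar>i\<bar> \<ge> int N \<or> \<bar>j\<bar> \<ge> int N" for i j
  proof (rule ccontr)
    assume "\<phi> (h * of_int i, h * of_int j) \<noteq> 0"
    then have "(h * of_int i, h * of_int j) \<in> U \<times> V" using K(3,4) by blast
    from R'[OF this] have "\<bar>h * of_int i\<bar> < R" "\<bar>h * of_int j\<bar> < R" by simp_all
    moreover have "R < h * real N" using N hpos by (simp add: right_diff_distrib)
    moreover have "\<bar>h * of_int i\<bar> = h * \<bar>of_int i\<bar>" "\<bar>h * of_int j\<bar> = h * \<bar>of_int j\<bar>"
      using hpos by (simp_all add: abs_mult)
    ultimately have "h * \<bar>of_int i\<bar> < h * real N" "h * \<bar>of_int j\<bar> < h * real N" by linarith+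
    then have "real_of_int \<bar>i\<bar> < real N" "real_of_int \<bar>j\<bar> < real N" using hpos by simp_all
    with that show False by linarith
  qed
  have osc: "\<bar>pderiv_dir \<phi> b (x', y') - pderiv_dir \<phi> b (x, y)\<bar> \<le> \<epsilon>"
    if "(x, y) \<in> U \<times> V" "\<bar>x' - x\<bar> \<le> 3 * h" "\<bar>y' - y\<bar> \<le> 3 * h" "7 * h \<le> D b" for b x y x' y'
  proof -
    have "(x, y) \<in> ?Q" "(x', y') \<in> ?Q"
      using R'[OF that(1)] that(2,3) h(3) unfolding cbox_Pair_eq by (auto simp: abs_le_iff abs_less_iff)
    moreover have "dist (x', y') (x, y) \<le> \<bar>x' - x\<bar> + \<bar>y' - y\<bar>"
      unfolding dist_Pair_Pair dist_real_def by (rule sqrt_sum_squares_le_sum_abs[THEN order.trans]) simp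
    then have "dist (x', y') (x, y) < D b" using that(2-4) hpos by linarith
    ultimately have "dist (pderiv_dir \<phi> b (x', y')) (pderiv_dir \<phi> b (x, y)) < \<epsilon>" by (rule D(2))
    then show ?thesis by (simp add: dist_real_def)
  qed
  have dx: "((\<lambda>x. \<phi> (x, y)) has_real_derivative pderiv_dir \<phi> (1, 0) (x, y)) (at x)" for x y
    using C1_line_has_derivative[OF K(1), of "(0, y)" "(1, 0)" x] by simp
  have dy: "((\<lambda>y. \<phi> (x, y)) has_real_derivative pderiv_dir \<phi> (0, 1) (x, y)) (at y)" for x y
    using C1_line_has_derivative[OF K(1), of "(x, 0)" "(0, 1)" y] by simp
  have "\<bar>pderiv_dir (\<lambda>z. \<Sum>i\<in>I. c i * tens (\<beta> (fst i)) (\<beta> (snd i)) z) b z - pderiv_dir \<phi> b z\<bar> \<le> \<epsilon>"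
    if z: "z \<in> U \<times> V" and b: "b \<in> Basis" for z b
  proof -
    obtain x y where xy: "z = (x, y)" by (cases z)
    with z have zxy: "(x, y) \<in> U \<times> V" by simp
    have lexy: "\<bar>x\<bar> \<le> h * (real N - 2)" "\<bar>y\<bar> \<le> h * (real N - 2)"
      using R'[OF zxy] N by linarith+
    have "b = (1, 0) \<or> b = (0, 1)" using b by (auto simp: Basis_prod_def)
    then show ?thesis
    proof
      assume b: "b = (1, 0)"
      have "\<bar>(\<Sum>i\<in>?Z. \<Sum>j\<in>?Z. \<phi> (h * of_int i, h * of_int j) *
          ((hat (x / h - of_int i) - hat (x / h - of_int i - 1)) / h) * bspl (y / h - of_int j))
          - pderiv_dir \<phi> (1, 0) (x, y)\<bar> \<le> \<epsilon>"
        by (rule bspl_quasi_interpolant_deriv[OF hpos dx far lexy osc[OF zxy _ _ h(4)]]) auto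
      then show ?thesis unfolding pd b xy tens_C1(2)[OF \<beta>C(1) \<beta>C(1)] tens_apply \<beta>C(2)
        by (simp add: \<beta>_def mult.assoc)
    next
      \<comment> \<open>The variables are exchanged in \<open>F\<close>, so the outer sum runs over
        \<open>j\<close>; \<open>sum.swap\<close> restores the original order.\<close>
      assume b: "b = (0, 1)"
      have "\<bar>(\<Sum>j\<in>?Z. \<Sum>i\<in>?Z. \<phi> (h * of_int i, h * of_int j) *
          ((hat (y / h - of_int j) - hat (y / h - of_int j - 1)) / h) * bspl (x / h - of_int i))
          - pderiv_dir \<phi> (0, 1) (x, y)\<bar> \<le> \<epsilon>"
        by (rule bspl_quasi_interpolant_deriv[of h "\<lambda>y x. \<phi> (x, y)" "\<lambda>y x. pderiv_dir \<phi> (0, 1) (x, y)",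
              OF hpos dy far lexy(2,1) osc[OF zxy _ _ h(5)]]) auto
      then show ?thesis unfolding pd b xy tens_C1(3)[OF \<beta>C(1) \<beta>C(1)] tens_apply \<beta>C(2)
        by (subst sum.swap) (simp add: \<beta>_def ac_simps)
    qed
  qed
  with fin p q show thesis by (rule that)
qed

lemma testC1_tens_approx:
  fixes \<phi> :: "real \<times> real \<Rightarrow> real"
  assumes U: "open U" "bounded U" and V: "open V" "bounded V"
    and \<phi>: "\<phi> \<in> testC1 (U \<times> V)" and e: "e > 0"
  obtains I :: "(int \<times> int) set" and c p q where "finite I"
    "\<And>i. i \<in> I \<Longrightarrow> p i \<in> testC1 U" "\<And>i. i \<in> I \<Longrightarrow> q i \<in> testC1 V"
    "dir (U \<times> V) (\<lambda>z. \<phi> z - (\<Sum>i\<in>I. c i * tens (p i) (q i) z)) (\<lambda>z. \<phi> z - (\<Sum>i\<in>I. c i * tens (p i) (q i) z)) \<le> e"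
proof -
  define m where "m = measure lebesgue (U \<times> V)"
  \<comment> \<open>The two partial derivatives contribute at most
    \<open>\<epsilon>\<^sup>2 * m\<close> each, whence the factor 2; the \<open>+ 1\<close> covers
    \<open>m = 0\<close>.\<close>
  define \<epsilon> where "\<epsilon> = sqrt (e / (2 * (m + 1)))"
  have m: "m \<ge> 0" by (simp add: m_def)
  then have pos: "e / (2 * (m + 1)) > 0" using e by simp
  then have \<epsilon>: "\<epsilon> > 0" by (simp add: \<epsilon>_def)
  have \<epsilon>2: "2 * (\<epsilon>\<^sup>2 * m) \<le> e"
  proof -
    have "2 * (\<epsilon>\<^sup>2 * m) = e * (m / (m + 1))" using pos m by (simp add: \<epsilon>_def divide_simps)
    also have "\<dots> \<le> e * 1" using e m by (intro mult_left_mono) auto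
    finally show ?thesis by simp
  qed
  obtain I :: "(int \<times> int) set" and c p q where fin: "finite I"
    and p: "\<And>i. i \<in> I \<Longrightarrow> p i \<in> testC1 U" and q: "\<And>i. i \<in> I \<Longrightarrow> q i \<in> testC1 V"
    and b: "\<And>z b. z \<in> U \<times> V \<Longrightarrow> b \<in> Basis \<Longrightarrow>
       \<bar>pderiv_dir (\<lambda>z. \<Sum>i\<in>I. c i * tens (p i) (q i) z) b z - pderiv_dir \<phi> b z\<bar> \<le> \<epsilon>"
    by (rule testC1_tens_approx_pderiv[OF U V \<phi> \<epsilon>]) blast
  let ?v = "\<lambda>z. \<Sum>i\<in>I. c i * tens (p i) (q i) z"
  have UV: "open (U \<times> V)" "bounded (U \<times> V)" using U V by (auto intro: open_Times bounded_Times)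
  have v: "?v \<in> testC1 (U \<times> V)"
    by (intro testC1_sum fin testC1_cmult tens_testC1 p q)
  have w: "(\<lambda>z. \<phi> z + (-1) * ?v z) \<in> testC1 (U \<times> V)"
    by (intro testC1_add testC1_cmult v \<phi>)
  have C: "C1 \<phi>" "C1 ?v" using \<phi> v unfolding testC1_iff by simp_all
  have wb: "\<bar>pderiv_dir (\<lambda>z. \<phi> z + (-1) * ?v z) b z\<bar> \<le> \<epsilon>" if "z \<in> U \<times> V" "b \<in> Basis" for z b
    using b[OF that] unfolding C1_add(2)[OF C(1) C1_cmult(1)[OF C(2)]] C1_cmult(2)[OF C(2)]
    by (simp add: abs_minus_commute)
  have "dir (U \<times> V) (\<lambda>z. \<phi> z + (-1) * ?v z) (\<lambda>z. \<phi> z + (-1) * ?v z)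
      \<le> (\<Sum>b\<in>(Basis :: (real \<times> real) set). \<epsilon>\<^sup>2 * m)"
    unfolding dir_testC1[OF UV(1) w]
    unfolding m_def by (intro sum_mono sqnorm_le_bound UV testC1_sqint(2)[OF UV(1) w] wb)
  also have "\<dots> \<le> e" using \<epsilon>2 by simp
  finally show thesis using fin p q by (intro that[of I p q c]) simp_all
qed

section \<open>The Dirichlet form\<close>

lemma H10_add_scaled:
  assumes "open U" "H10 U u" "H10 U v"
  shows "H10 U (\<lambda>x. u x + c * v x)"
  using assms H10_grad_add_scaled[OF assms(1)] unfolding H10_iff_H10_grad[OF assms(1)] by blast

lemma H10_testC1: "open U \<Longrightarrow> \<phi> \<in> testC1 U \<Longrightarrow> H10 U \<phi>"
  using testC1_H10_grad[of U \<phi>] unfolding H10_iff_H10_grad by blast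

lemma H10_0: "open U \<Longrightarrow> H10 U (\<lambda>x. 0)"
  by (simp add: H10_testC1)

lemma H10_cmult: "open U \<Longrightarrow> H10 U u \<Longrightarrow> H10 U (\<lambda>x. c * u x)"
  using H10_add_scaled[of U "\<lambda>x. 0" u c] H10_0[of U] by simp

lemma H10_diff: "open U \<Longrightarrow> H10 U u \<Longrightarrow> H10 U v \<Longrightarrow> H10 U (\<lambda>x. u x - v x)"
  using H10_add_scaled[of U u v "-1"] by simp

lemma H10_sum:
  assumes "open U" "finite I" "\<And>i. i \<in> I \<Longrightarrow> H10 U (w i)"
  shows "H10 U (\<lambda>x. \<Sum>i\<in>I. c i * w i x)"
  using assms(2,3)
proof (induction I rule: finite_induct)
  case empty show ?case using H10_0[OF assms(1)] by simp
next
  case (insert i I)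
  then have "H10 U (\<lambda>x. \<Sum>i\<in>I. c i * w i x)" "H10 U (w i)" by simp_all
  from H10_add_scaled[OF assms(1) this, of "c i"] show ?case using insert by (simp add: add.commute)
qed

lemma H10_tens:
  assumes "open U" "open V" "H10 U r" "H10 V s"
  shows "H10 (U \<times> V) (tens r s)"
  using assms H10_grad_tens[OF assms(1,2)]
  unfolding H10_iff_H10_grad[OF assms(1)] H10_iff_H10_grad[OF assms(2)]
    H10_iff_H10_grad[OF open_Times[OF assms(1,2)]] by blast

lemma dir_commute: "dir U u v = dir U v u"
  by (simp add: dir_def inner_commute)

lemma dir_nonneg: "0 \<le> dir U u u"
  unfolding dir_def set_lebesgue_integral_def by (intro Bochner_Integration.integral_nonneg) simp

text \<open>\<open>wgrad\<close> of a combination agrees with the combination of the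
  \<open>wgrad\<close>s only a.e., so the computation uses explicit gradients, which combine
  pointwise.\<close>

lemma dir_add_scaled_left:
  assumes U: "open U" and H: "H10 U u" "H10 U v" "H10 U w"
  shows "dir U (\<lambda>x. u x + c * v x) w = dir U u w + c * dir U v w"
proof -
  obtain F G H where G: "H10_grad U u F" "H10_grad U v G" "H10_grad U w H"
    using H unfolding H10_iff_H10_grad[OF U] by (elim exE)
  have i: "sqint (lebesgue_on U) (\<lambda>x. F x \<bullet> b)" "sqint (lebesgue_on U) (\<lambda>x. G x \<bullet> b)"
    "sqint (lebesgue_on U) (\<lambda>x. H x \<bullet> b)" if "b \<in> Basis" for b
    using G that unfolding H10_grad_def by (auto intro: sqint_fieldD)
  have "(LINT x|lebesgue_on U. ((F x + c *\<^sub>R G x) \<bullet> b) * (H x \<bullet> b))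
      = (LINT x|lebesgue_on U. (F x \<bullet> b) * (H x \<bullet> b)) + c * (LINT x|lebesgue_on U. (G x \<bullet> b) * (H x \<bullet> b))"
    if b: "b \<in> Basis" for b
    using sqint_mult_integrable[OF i(1)[OF b] i(3)[OF b]] sqint_mult_integrable[OF i(2)[OF b] i(3)[OF b]]
    by (simp add: inner_add_left distrib_right mult.assoc)
  then show ?thesis
    unfolding dir_H10_grad[OF U H10_grad_add_scaled[OF U G(1,2)] G(3)] dir_H10_grad[OF U G(1,3)]
      dir_H10_grad[OF U G(2,3)]
    by (simp add: sum.distrib sum_distrib_left)
qed

lemma dir_add_scaled_right:
  assumes "open U" "H10 U u" "H10 U v" "H10 U w"
  shows "dir U w (\<lambda>x. u x + c * v x) = dir U w u + c * dir U w v"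
  using dir_add_scaled_left[OF assms] by (simp add: dir_commute[of U w])

lemma dir_sum_right:
  assumes U: "open U" and I: "finite I" "\<And>i. i \<in> I \<Longrightarrow> H10 U (w i)" and u: "H10 U u"
  shows "dir U u (\<lambda>x. \<Sum>i\<in>I. c i * w i x) = (\<Sum>i\<in>I. c i * dir U u (w i))"
  using I
proof (induction I rule: finite_induct)
  case empty
  \<comment> \<open>Additivity at \<open>0 + 1 * 0\<close> gives \<open>a = a + a\<close>, so the
    form vanishes at the zero function.\<close>
  show ?case using dir_add_scaled_right[OF U H10_0[OF U] H10_0[OF U] u, of 1] by simp
next
  case (insert i I)
  then have *: "H10 U (\<lambda>x. \<Sum>i\<in>I. c i * w i x)" "H10 U (w i)" by (simp_all add: H10_sum[OF U])
  from dir_add_scaled_right[OF U * u, of "c i"] show ?case using insert by (simp add: add.commute)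
qed

lemma dir_add_scaled_self:
  assumes "open U" "H10 U u" "H10 U v"
  shows "dir U (\<lambda>x. u x + c * v x) (\<lambda>x. u x + c * v x) = dir U u u + 2 * c * dir U u v + c\<^sup>2 * dir U v v"
  using dir_add_scaled_left[OF assms H10_add_scaled[OF assms], of c c]
    dir_add_scaled_right[OF assms assms(2), of c] dir_add_scaled_right[OF assms assms(3), of c]
  by (simp add: dir_commute[of U v u] algebra_simps power2_eq_square)

lemma dir_Cauchy_Schwarz:
  assumes "open U" "H10 U u" "H10 U v"
  shows "(dir U u v)\<^sup>2 \<le> dir U u u * dir U v v"
proof (rule discriminant_le)
  show "0 \<le> dir U u u + 2 * t * dir U u v + t\<^sup>2 * dir U v v" for t
    using dir_nonneg[of U "\<lambda>x. u x + t * v x"] dir_add_scaled_self[OF assms, of t] by simp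
qed

text \<open>Test functions are dense by the definition of \<open>H10\<close>, and tensor sums
  approximate them in the Dirichlet form, which the squared H^1 norm dominates.\<close>

lemma H10_tens_dense:
  fixes g :: "real \<times> real \<Rightarrow> real"
  assumes U: "open U" "bounded U" and V: "open V" "bounded V" and g: "H10 (U \<times> V) g" and e: "e > 0"
  obtains I :: "(int \<times> int) set" and c p q where "finite I"
    "\<And>i. i \<in> I \<Longrightarrow> H10 U (p i)" "\<And>i. i \<in> I \<Longrightarrow> H10 V (q i)"
    "dir (U \<times> V) (\<lambda>z. g z - (\<Sum>i\<in>I. c i * tens (p i) (q i) z)) (\<lambda>z. g z - (\<Sum>i\<in>I. c i * tens (p i) (q i) z)) \<le> e"
proof -
  have UV: "open (U \<times> V)" using U V by (intro open_Times)
  obtain \<phi> where \<phi>: "\<And>k. \<phi> k \<in> testC1 (U \<times> V)" "(\<lambda>k. H1_normsq (U \<times> V) (\<lambda>z. \<phi> k z - g z)) \<longlonglongrightarrow> 0"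
    using g unfolding H10_def by (elim conjE exE) (rule that; (assumption | erule spec))
  have "\<forall>\<^sub>F k in sequentially. H1_normsq (U \<times> V) (\<lambda>z. \<phi> k z - g z) < e / 4"
    using order_tendstoD(2)[OF \<phi>(2), of "e / 4"] e by simp
  then obtain k where k: "H1_normsq (U \<times> V) (\<lambda>z. \<phi> k z - g z) < e / 4"
    unfolding eventually_sequentially by blast
  have "0 \<le> (LINT z:U \<times> V|lebesgue. (\<phi> k z - g z)\<^sup>2)"
    unfolding set_lebesgue_integral_def by (intro Bochner_Integration.integral_nonneg) simp
  with k have 1: "dir (U \<times> V) (\<lambda>z. \<phi> k z - g z) (\<lambda>z. \<phi> k z - g z) \<le> e / 4"
    unfolding H1_normsq_def by linarith
  obtain I :: "(int \<times> int) set" and c p q where fin: "finite I"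
    and p: "\<And>i. i \<in> I \<Longrightarrow> p i \<in> testC1 U" and q: "\<And>i. i \<in> I \<Longrightarrow> q i \<in> testC1 V"
    and 2: "dir (U \<times> V) (\<lambda>z. \<phi> k z - (\<Sum>i\<in>I. c i * tens (p i) (q i) z)) (\<lambda>z. \<phi> k z - (\<Sum>i\<in>I. c i * tens (p i) (q i) z)) \<le> e / 4"
    by (rule testC1_tens_approx[OF U V \<phi>(1)[of k], of "e / 4"]) (use e in \<open>auto\<close>)
  let ?v = "\<lambda>z. \<Sum>i\<in>I. c i * tens (p i) (q i) z"
  have pH: "H10 U (p i)" "H10 V (q i)" if "i \<in> I" for i
    using p[OF that] q[OF that] U V by (auto intro: H10_testC1)
  have v: "H10 (U \<times> V) ?v" by (intro H10_sum UV fin H10_tens U(1) V(1) pH)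
  have \<phi>H: "H10 (U \<times> V) (\<phi> k)" by (rule H10_testC1[OF UV \<phi>(1)])
  let ?a = "\<lambda>z. \<phi> k z - ?v z" and ?b = "\<lambda>z. \<phi> k z - g z"
  have ab: "H10 (U \<times> V) ?a" "H10 (U \<times> V) ?b" by (intro H10_diff UV \<phi>H v g)+
  \<comment> \<open>The remainder is \<open>?a - ?b\<close>. The parallelogram identity bounds its
    energy by twice the sum of both energies, hence the two tolerances \<open>e / 4\<close>.\<close>
  have "dir (U \<times> V) (\<lambda>z. ?a z + (-1) * ?b z) (\<lambda>z. ?a z + (-1) * ?b z)
      \<le> 2 * dir (U \<times> V) ?a ?a + 2 * dir (U \<times> V) ?b ?b"
    using dir_add_scaled_self[OF UV ab, of "-1"] dir_add_scaled_self[OF UV ab, of 1]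
      dir_nonneg[of "U \<times> V" "\<lambda>z. ?a z + 1 * ?b z"] by simp
  also have "\<dots> \<le> e" using 1 2 by simp
  finally show thesis using fin pH by (intro that[of I p q c]) simp_all
qed

section \<open>Convergence of the greedy algorithm\<close>

lemma tens_cmult_left: "tens (\<lambda>x. t * r x) s = (\<lambda>z. t * tens r s z)"
  by (simp add: tens_eq fun_eq_iff)

text \<open>\<open>pair n\<close> is the functional \<open>f + \<Delta> u\<^sub>n\<close> after
  integration by parts. For \<open>n = 0\<close> the sum \<open>u 0\<close> is empty, so it pairs
  with \<open>f\<close> alone on H^1_0. Iterations start at 1, hence the series are indexed by
  \<open>Suc n\<close>.\<close>

theorem theorem2:
  fixes Ox Oy :: "real set" and Om :: "(real \<times> real) set"
    and f g :: "real \<times> real \<Rightarrow> real"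
    and r s :: "nat \<Rightarrow> real \<Rightarrow> real" and \<alpha> :: "nat \<Rightarrow> nat \<Rightarrow> real"
    and u :: "nat \<Rightarrow> real \<times> real \<Rightarrow> real"
    and pair :: "nat \<Rightarrow> (real \<times> real \<Rightarrow> real) \<Rightarrow> real"
    and E :: "nat \<Rightarrow> real"
  assumes Ox: "is_domain Ox" "bounded Ox"
    and Oy: "is_domain Oy" "bounded Oy"
    and O_def: "Om = Ox \<times> Oy"
    and f: "L2 Om f"
    and g: "H10 Om g" "\<forall>v. H10 Om v \<longrightarrow> dir Om g v = (LINT z:Om|lebesgue. f z * v z)"
    and u_def: "\<And>n. u n = (\<lambda>z. \<Sum>k\<in>{1..n}. \<alpha> n k * tens (r k) (s k) z)"
    and pair_def: "\<And>n w. pair n w = (LINT z:Om|lebesgue. f z * w z) - dir Om (u n) w"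
    and rs: "\<And>n. n \<ge> 1 \<Longrightarrow> H10 Ox (r n) \<and> H10 Oy (s n)"
    and galerkin: "\<And>n r' s'. n \<ge> 1 \<Longrightarrow> H10 Ox r' \<Longrightarrow> H10 Oy s' \<Longrightarrow>
        dir Om (tens (r n) (s n)) (\<lambda>z. tens (r n) s' z + tens r' (s n) z)
          = pair (n - 1) (\<lambda>z. tens (r n) s' z + tens r' (s n) z)"
    and alpha_min: "\<And>n \<beta>. n \<ge> 1 \<Longrightarrow>
        (let v = (\<lambda>z. \<Sum>k\<in>{1..n}. \<alpha> n k * tens (r k) (s k) z)
         in 1/2 * dir Om v v - (LINT z:Om|lebesgue. f z * v z))
        \<le> (let v = (\<lambda>z. \<Sum>k\<in>{1..n}. \<beta> k * tens (r k) (s k) z)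
         in 1/2 * dir Om v v - (LINT z:Om|lebesgue. f z * v z))"
    and E_def: "\<And>n. E n = 1/2 * dir Om (tens (r n) (s n)) (tens (r n) (s n))
                         - pair (n - 1) (tens (r n) (s n))"
  shows "summable (\<lambda>n. dir Om (tens (r (Suc n)) (s (Suc n))) (tens (r (Suc n)) (s (Suc n))))
       \<and> summable (\<lambda>n. E (Suc n))
       \<and> (\<Sum>n. dir Om (tens (r (Suc n)) (s (Suc n))) (tens (r (Suc n)) (s (Suc n))))
           = -2 * (\<Sum>n. E (Suc n))
       \<and> ((\<forall>n\<ge>1. \<forall>r' s'. H10 Ox r' \<longrightarrow> H10 Oy s' \<longrightarrow>
              1/2 * dir Om (tens (r n) (s n)) (tens (r n) (s n)) - pair (n - 1) (tens (r n) (s n))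
              \<le> 1/2 * dir Om (tens r' s') (tens r' s') - pair (n - 1) (tens r' s'))
          \<longrightarrow> (\<lambda>n. H10_norm Om (\<lambda>z. g z - u n z)) \<longlonglongrightarrow> 0)"
proof -
  let ?a = "dir Om"
  let ?W = "\<lambda>k. tens (r k) (s k)"
  let ?e = "\<lambda>n z. g z - u n z"
  have op: "open Ox" "open Oy" using Ox(1) Oy(1) by (simp_all add: is_domain_def)
  then have OM: "open Om" unfolding O_def by (rule open_Times)
  have T: "H10 Om (tens p q)" if "H10 Ox p" "H10 Oy q" for p q
    unfolding O_def by (rule H10_tens[OF op that])
  have W: "H10 Om (?W k)" if "k \<ge> 1" for k using rs[OF that] T by blast
  have comb: "H10 Om (\<lambda>z. \<Sum>k\<in>{1..n}. \<beta> k * ?W k z)" for n \<beta>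
    by (rule H10_sum[OF OM]) (simp_all add: W)
  have uH: "H10 Om (u n)" for n unfolding u_def by (rule comb)
  have eH: "H10 Om (?e n)" for n by (rule H10_diff[OF OM g(1) uH])
  have e_left: "?a (?e n) w = ?a g w - ?a (u n) w" if "H10 Om w" for n w
    using dir_add_scaled_left[OF OM g(1) uH[of n] that, where c = "-1"] by simp
  \<comment> \<open>The weak equation for \<open>g\<close> turns the residual pairing into the
    Dirichlet form against the error; from here on the argument is Hilbert space geometry.\<close>
  have pair: "pair n w = ?a (?e n) w" if "H10 Om w" for n w
    unfolding pair_def e_left[OF that] using g(2) that by simp
  have diff_self: "?a (\<lambda>z. x z - y z) (\<lambda>z. x z - y z) = ?a x x - 2 * ?a x y + ?a y y"
    if "H10 Om x" "H10 Om y" for x y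
    using dir_add_scaled_self[OF OM that, of "-1"] by simp

  \<comment> \<open>Completing the square: the energy of \<open>v\<close> is half the squared
    distance to \<open>g\<close> minus the constant \<open>a(g, g) / 2\<close>, so its minimiser is
    a best approximation of \<open>g\<close>.\<close>
  have opt: "?a (?e n) (?e n) \<le> ?a (\<lambda>z. g z - v z) (\<lambda>z. g z - v z)"
    if n: "n \<ge> 1" and v: "v = (\<lambda>z. \<Sum>k\<in>{1..n}. \<beta> k * ?W k z)" for n v \<beta>
  proof -
    have vH: "H10 Om v" unfolding v by (rule comb)
    have "1/2 * ?a (u n) (u n) - ?a g (u n) \<le> 1/2 * ?a v v - ?a g v"
      using alpha_min[OF n, of \<beta>] g(2) uH[of n] vH unfolding Let_def u_def[of n, symmetric] v[symmetric] by simp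
    then show ?thesis unfolding diff_self[OF g(1) uH] diff_self[OF g(1) vH] by linarith
  qed

  have WW: "?a (?W n) (?W n) = ?a (?e (n - 1)) (?W n)" if n: "n \<ge> 1" for n
  proof -
    note Wn = W[OF n]
    \<comment> \<open>With \<open>(r n, s n)\<close> as test pair both summands equal the tensor
      product itself, and the resulting factor 2 cancels.\<close>
    have dbl: "?a w (\<lambda>z. ?W n z + ?W n z) = 2 * ?a w (?W n)" if "H10 Om w" for w
      using dir_add_scaled_right[OF OM Wn Wn that, of 1] by simp
    have "H10 Om (\<lambda>z. ?W n z + ?W n z)" using H10_add_scaled[OF OM Wn Wn, of 1] by simp
    from galerkin[OF n, of "r n" "s n"] rs[OF n] pair[OF this] dbl[OF Wn] dbl[OF eH]
    show ?thesis by simp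
  qed
  have E: "E n = - (1/2) * ?a (?W n) (?W n)" if n: "n \<ge> 1" for n
    unfolding E_def pair[OF W[OF n]] using WW[OF n] by simp

  have dec: "?a (?e (Suc n)) (?e (Suc n)) \<le> ?a (?e n) (?e n) - ?a (?W (Suc n)) (?W (Suc n))" for n
  proof -
    let ?\<beta> = "\<lambda>k. if k = Suc n then 1 else \<alpha> n k"
    let ?v = "\<lambda>z. \<Sum>k\<in>{1..Suc n}. ?\<beta> k * ?W k z"
    have "?v z = u n z + ?W (Suc n) z" for z
    proof -
      have "(\<Sum>k\<in>{1..n}. ?\<beta> k * ?W k z) = (\<Sum>k\<in>{1..n}. \<alpha> n k * ?W k z)"
        by (intro sum.cong) auto
      then show ?thesis by (simp add: u_def)
    qed
    then have v: "(\<lambda>z. g z - ?v z) = (\<lambda>z. ?e n z - ?W (Suc n) z)" by (simp add: fun_eq_iff)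
    have "?a (?e (Suc n)) (?e (Suc n)) \<le> ?a (\<lambda>z. g z - ?v z) (\<lambda>z. g z - ?v z)"
      by (rule opt[OF _ refl]) simp
    also have "\<dots> = ?a (?e n) (?e n) - 2 * ?a (?e n) (?W (Suc n)) + ?a (?W (Suc n)) (?W (Suc n))"
      unfolding v by (rule diff_self[OF eH W]) simp
    also have "\<dots> = ?a (?e n) (?e n) - ?a (?W (Suc n)) (?W (Suc n))"
      using WW[of "Suc n"] by simp
    finally show ?thesis .
  qed
  have partial: "(\<Sum>k<n. ?a (?W (Suc k)) (?W (Suc k))) \<le> ?a (?e 0) (?e 0) - ?a (?e n) (?e n)" for n
  proof (induction n)
    case (Suc n) then show ?case using dec[of n] by simp
  qed simp
  have sumW: "summable (\<lambda>n. ?a (?W (Suc n)) (?W (Suc n)))"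
  proof (rule summableI_nonneg_bounded)
    show "(\<Sum>k<n. ?a (?W (Suc k)) (?W (Suc k))) \<le> ?a (?e 0) (?e 0)" for n
      using partial[of n] dir_nonneg[of Om "?e n"] by linarith
  qed (rule dir_nonneg)
  have ESuc: "E (Suc n) = - (1/2) * ?a (?W (Suc n)) (?W (Suc n))" for n by (rule E) simp
  have sumE: "summable (\<lambda>n. E (Suc n))" unfolding ESuc by (rule summable_mult[OF sumW])
  have eqE: "(\<Sum>n. ?a (?W (Suc n)) (?W (Suc n))) = -2 * (\<Sum>n. E (Suc n))"
    unfolding ESuc suminf_mult[OF sumW] by simp

  have "(\<lambda>n. H10_norm Om (?e n)) \<longlonglongrightarrow> 0"
    if greedy: "\<forall>n\<ge>1. \<forall>r' s'. H10 Ox r' \<longrightarrow> H10 Oy s' \<longrightarrow>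
      1/2 * ?a (?W n) (?W n) - pair (n - 1) (?W n) \<le> 1/2 * ?a (tens r' s') (tens r' s') - pair (n - 1) (tens r' s')"
  proof -
    \<comment> \<open>All multiples of \<open>u n\<close> are admissible competitors. The quadratic
      in \<open>t\<close> has no constant term, so nonnegativity for every \<open>t\<close> forces
      its linear coefficient to vanish.\<close>
    have orth: "?a (?e n) (u n) = 0" for n
    proof (cases "n \<ge> 1")
      case True
      have "(- ?a (?e n) (u n))\<^sup>2 \<le> 0 * ?a (u n) (u n)"
      proof (rule discriminant_le)
        fix t :: real
        have "(\<lambda>z. (1 + t) * u n z) = (\<lambda>z. \<Sum>k\<in>{1..n}. ((1 + t) * \<alpha> n k) * ?W k z)"
          by (simp add: u_def sum_distrib_left mult.assoc)
        from opt[OF True this] have "?a (?e n) (?e n) \<le> ?a (\<lambda>z. ?e n z - t * u n z) (\<lambda>z. ?e n z - t * u n z)"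
          by (simp add: algebra_simps)
        also have "\<dots> = ?a (?e n) (?e n) - 2 * t * ?a (?e n) (u n) + t\<^sup>2 * ?a (u n) (u n)"
          using dir_add_scaled_self[OF OM eH[of n] uH[of n], where c = "- t"] by simp
        finally show "0 \<le> 0 + 2 * t * (- ?a (?e n) (u n)) + t\<^sup>2 * ?a (u n) (u n)" by simp
      qed
      then show ?thesis by simp
    next
      case False
      then have "u n = (\<lambda>z. 0)" by (simp add: u_def)
      then show ?thesis using dir_add_scaled_right[OF OM uH[of n] uH[of n] eH[of n], where c = 1] by simp
    qed
    have ee: "?a (?e n) (?e n) = ?a (?e n) g" for n
      using dir_add_scaled_right[OF OM g(1) uH[of n] eH[of n], where c = "-1"] orth[of n] by simp
    \<comment> \<open>The scalar \<open>t\<close> is absorbed into the first factor, so the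
      competitor remains a tensor product. The minimal energy is \<open>- a(w, w) / 2\<close> for
      the new product \<open>w\<close>; doubling the minimality inequality gives a quadratic
      nonnegative for all \<open>t\<close>.\<close>
    have weak: "(?a (?e n) (tens p q))\<^sup>2 \<le> ?a (?W (Suc n)) (?W (Suc n)) * ?a (tens p q) (tens p q)"
      if pq: "H10 Ox p" "H10 Oy q" for n p q
    proof -
      note Tpq = T[OF pq]
      have "(- ?a (?e n) (tens p q))\<^sup>2 \<le> ?a (?W (Suc n)) (?W (Suc n)) * ?a (tens p q) (tens p q)"
      proof (rule discriminant_le)
        fix t :: real
        let ?w = "\<lambda>z. t * tens p q z"
        have tp: "H10 Ox (\<lambda>x. t * p x)" by (rule H10_cmult[OF op(1) pq(1)])
        have wH: "H10 Om ?w" by (rule H10_cmult[OF OM Tpq])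
        have z: "?a x ?w = t * ?a x (tens p q)" if "H10 Om x" for x
          using dir_add_scaled_right[OF OM H10_0[OF OM] Tpq that, where c = t]
            dir_add_scaled_right[OF OM H10_0[OF OM] H10_0[OF OM] that, where c = 1] by simp
        have "1/2 * ?a (?W (Suc n)) (?W (Suc n)) - pair n (?W (Suc n)) \<le> 1/2 * ?a ?w ?w - pair n ?w"
        proof -
          have "Suc n \<ge> 1" by simp
          from greedy[rule_format, OF this tp pq(2)] show ?thesis
            unfolding tens_cmult_left diff_Suc_1 .
        qed
        moreover have "pair n (?W (Suc n)) = ?a (?W (Suc n)) (?W (Suc n))"
          using WW[of "Suc n"] pair[OF W[of "Suc n"], of n] by simp
        moreover have "?a ?w ?w = t\<^sup>2 * ?a (tens p q) (tens p q)"
          using z[OF wH] z[OF Tpq] by (simp add: dir_commute[of Om ?w "tens p q"] power2_eq_square)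
        ultimately show "0 \<le> ?a (?W (Suc n)) (?W (Suc n)) + 2 * t * (- ?a (?e n) (tens p q))
            + t\<^sup>2 * ?a (tens p q) (tens p q)"
          using z[OF eH] pair[OF wH, of n] by simp
      qed
      then show ?thesis by simp
    qed
    have W0: "(\<lambda>n. ?a (?W (Suc n)) (?W (Suc n))) \<longlonglongrightarrow> 0" by (rule summable_LIMSEQ_zero[OF sumW])
    have weak0: "(\<lambda>n. ?a (?e n) (tens p q)) \<longlonglongrightarrow> 0" if pq: "H10 Ox p" "H10 Oy q" for p q
    proof -
      have "(\<lambda>n. (?a (?e n) (tens p q))\<^sup>2) \<longlonglongrightarrow> 0"
      proof (rule tendsto_sandwich[OF _ _ tendsto_const])
        show "(\<lambda>n. ?a (?W (Suc n)) (?W (Suc n)) * ?a (tens p q) (tens p q)) \<longlonglongrightarrow> 0"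
          using tendsto_mult_right[OF W0, of "?a (tens p q) (tens p q)"] by simp
      qed (use weak[OF pq] in auto)
      then show ?thesis by simp
    qed
    have bnd: "?a (?e n) (?e n) \<le> ?a (?e 0) (?e 0)" for n
    proof -
      have "0 \<le> (\<Sum>k<n. ?a (?W (Suc k)) (?W (Suc k)))" by (intro sum_nonneg dir_nonneg)
      then show ?thesis using partial[of n] by linarith
    qed
    \<comment> \<open>By \<open>ee\<close> the energy is
      \<open>a(e\<^sub>n, v) + a(e\<^sub>n, g - v)\<close>. A tensor sum \<open>v\<close> is fixed
      first, making the second term small uniformly in \<open>n\<close>; the first then tends to
      0.\<close>
    have "(\<lambda>n. ?a (?e n) (?e n)) \<longlonglongrightarrow> 0"
    proof (rule LIMSEQ_I)
      fix \<epsilon> :: real assume \<epsilon>: "\<epsilon> > 0"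
      \<comment> \<open>The \<open>+ 1\<close> keeps \<open>C\<close> positive when the initial
        error is 0; \<open>\<delta>\<close> is chosen so that Cauchy-Schwarz yields exactly
        \<open>\<epsilon> / 2\<close>.\<close>
      define C where "C = ?a (?e 0) (?e 0) + 1"
      have C: "C > 0" using dir_nonneg[of Om "?e 0"] by (simp add: C_def)
      define \<delta> where "\<delta> = (\<epsilon> / 2)\<^sup>2 / C"
      have \<delta>: "\<delta> > 0" using \<epsilon> C by (simp add: \<delta>_def)
      obtain I :: "(int \<times> int) set" and c p q where fin: "finite I"
        and pq: "\<And>i. i \<in> I \<Longrightarrow> H10 Ox (p i)" "\<And>i. i \<in> I \<Longrightarrow> H10 Oy (q i)"
        and close: "?a (\<lambda>z. g z - (\<Sum>i\<in>I. c i * tens (p i) (q i) z)) (\<lambda>z. g z - (\<Sum>i\<in>I. c i * tens (p i) (q i) z)) \<le> \<delta>"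
        unfolding O_def
        by (rule H10_tens_dense[OF op(1) Ox(2) op(2) Oy(2) g(1)[unfolded O_def] \<delta>]) blast
      let ?v = "\<lambda>z. \<Sum>i\<in>I. c i * tens (p i) (q i) z"
      have TI: "H10 Om (tens (p i) (q i))" if "i \<in> I" for i by (rule T[OF pq[OF that]])
      have vH: "H10 Om ?v" by (rule H10_sum[OF OM fin TI])
      have dH: "H10 Om (\<lambda>z. g z - ?v z)" by (rule H10_diff[OF OM g(1) vH])
      have "?a (?e n) ?v = (\<Sum>i\<in>I. c i * ?a (?e n) (tens (p i) (q i)))" for n
        by (rule dir_sum_right[OF OM fin TI eH])
      moreover have "(\<lambda>n. \<Sum>i\<in>I. c i * ?a (?e n) (tens (p i) (q i))) \<longlonglongrightarrow> (\<Sum>i\<in>I. c i * 0)"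
        by (intro tendsto_sum tendsto_mult_left weak0 pq)
      ultimately have "(\<lambda>n. ?a (?e n) ?v) \<longlonglongrightarrow> 0" by simp
      from LIMSEQ_D[OF this, of "\<epsilon> / 2"] \<epsilon>
      obtain n0 where n0: "\<And>n. n \<ge> n0 \<Longrightarrow> \<bar>?a (?e n) ?v\<bar> < \<epsilon> / 2" by auto
      have "\<bar>?a (?e n) (?e n)\<bar> < \<epsilon>" if "n \<ge> n0" for n
      proof -
        have "(?a (?e n) (\<lambda>z. g z - ?v z))\<^sup>2 \<le> ?a (?e n) (?e n) * ?a (\<lambda>z. g z - ?v z) (\<lambda>z. g z - ?v z)"
          by (rule dir_Cauchy_Schwarz[OF OM eH dH])
        also have "\<dots> \<le> C * \<delta>"
          using bnd[of n] C close by (intro mult_mono dir_nonneg) (auto simp: C_def)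
        also have "\<dots> = (\<epsilon> / 2)\<^sup>2" using C by (simp add: \<delta>_def)
        finally have "\<bar>?a (?e n) (\<lambda>z. g z - ?v z)\<bar> \<le> \<epsilon> / 2"
          using \<epsilon> by (intro power2_le_imp_le[of "\<bar>_\<bar>"]) auto
        moreover have "?a (?e n) (\<lambda>z. g z - ?v z) = ?a (?e n) g - ?a (?e n) ?v"
          using dir_add_scaled_right[OF OM g(1) vH eH[of n], where c = "-1"] by simp
        ultimately show ?thesis using n0[OF that] ee[of n] by linarith
      qed
      then show "\<exists>n0. \<forall>n\<ge>n0. norm (?a (?e n) (?e n) - 0) < \<epsilon>" by auto
    qed
    from tendsto_real_sqrt[OF this] show ?thesis by (simp add: H10_norm_def)
  qed
  then show ?thesis using sumW sumE eqE by simp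
qed

end
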